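(* There exists a universal constant $C>0$ such that for every constant $p_0>0$ there is a constant $c>0$ (depending only on $p_0$) with the following property. Let $m,n,N\ge 1$ be integers and let $0<\varepsilon<C$. Let $T$ be the random $m\times n$ Toeplitz matrix and $D$ the random $n\times n$ diagonal matrix whose defining entries $t_{-(m-1)},\dots,t_{n-1},d_1,\dots,d_n$ are i.i.d. Rademacher random variables. If for every set $X\subset\mathbb{R}^n$ of $N$ vectors $$\Pr\left[\forall x,y\in X:\ \left|\left\|\tfrac{1}{\sqrt m}TDx-\tfrac{1}{\sqrt m}TDy\right\|_2^2-\|x-y\|_2^2\right|\le\varepsilon\|x-y\|_2^2\right]\ge p_0,$$ then $m\ge c\,\varepsilon^{-2}\lg^2 N$ or $m\ge c\,n/N$.
   Context: A Rademacher random variable is uniform on $\{-1,+1\}$. Given random variables $t_{-(m-1)},t_{-(m-2)},\dots,t_{n-1}$ and $d_1,\dots,d_n$, the Toeplitz matrix $T$ is the $m\times n$ matrix with $(i,j)$ entry $t_{j-i}$ for $i=1,\dots,m$, $j=1,\dots,n$, and $D$ is the $n\times n$ diagonal matrix with $i$-th diagonal entry $d_i$. $\lg$ is the base-2 logarithm. *)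

theory Defs
  imports
    "HOL-Probability.Probability"
    "Jordan_Normal_Form.Matrix"
begin

text \<open>
  Matrices and vectors are those of \<^theory>\<open>Jordan_Normal_Form.Matrix\<close>, whose dimensions are
  natural numbers, so that they can be quantified inside a formula.
\<close>

unbundle no vec_syntax
hide_const (open) Finite_Cartesian_Product.vec Finite_Cartesian_Product.mat
  Finite_Cartesian_Product.row Finite_Cartesian_Product.column

text \<open>
  Indices of matrices start at 0 here. The Toeplitz entry is not affected, since it only depends
  on the difference of the column and the row index.
\<close>

definition toeplitz_mat :: "nat \<Rightarrow> nat \<Rightarrow> (int \<Rightarrow> real) \<Rightarrow> real mat" where
  "toeplitz_mat m n t = mat m n (\<lambda>(i, j). t (int j - int i))"

text \<open>The diagonal entries are numbered $d_1, \dots, d_n$, hence the index shift.\<close>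

definition diagonal_mat_of :: "nat \<Rightarrow> (nat \<Rightarrow> real) \<Rightarrow> real mat" where
  "diagonal_mat_of n d = mat_diag n (\<lambda>i. d (i + 1))"

definition l2_norm :: "real vec \<Rightarrow> real" where
  "l2_norm v = L2_set (\<lambda>i. v $ i) {..<dim_vec v}"

definition rademacher_pmf :: "real pmf" where
  "rademacher_pmf = pmf_of_set {-1, 1}"

text \<open>
  An outcome \<open>\<omega>\<close> consists of all defining entries, \<open>\<omega> (Inl k)\<close> being $t_k$ and \<open>\<omega> (Inr i)\<close>
  being $d_i$. Outside the index set it takes the irrelevant value 0.
\<close>

definition entry_indices :: "nat \<Rightarrow> nat \<Rightarrow> (int + nat) set" where
  "entry_indices m n = {- (int m - 1)..int n - 1} <+> {1..n}"

definition entries_pmf :: "nat \<Rightarrow> nat \<Rightarrow> (int + nat \<Rightarrow> real) pmf" where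
  "entries_pmf m n = Pi_pmf (entry_indices m n) 0 (\<lambda>_. rademacher_pmf)"

lemma finite_entry_indices: "finite (entry_indices m n)"
  by (simp add: entry_indices_def)

lemma entries_pmf_indep:
  "prob_space.indep_vars (measure_pmf (entries_pmf m n)) (\<lambda>_. count_space UNIV)
     (\<lambda>k \<omega>. \<omega> k) (entry_indices m n)"
  unfolding entries_pmf_def by (rule indep_vars_Pi_pmf[OF finite_entry_indices])

lemma entries_pmf_component:
  "k \<in> entry_indices m n \<Longrightarrow> map_pmf (\<lambda>\<omega>. \<omega> k) (entries_pmf m n) = rademacher_pmf"
  unfolding entries_pmf_def by (simp add: Pi_pmf_component[OF finite_entry_indices])

end

theory Submission
  imports Defs
begin

text \<open>
  If \<open>m\<close> is small compared to \<open>n / N\<close>, then \<open>N - 1\<close> indicator vectors can be placed in blocks so far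
  apart that their images under \<open>TD\<close> depend on disjoint sets of random signs. Each block carries two
  combs of \<open>s \<approx> 12 \<epsilon> \<surd>m\<close> columns with spacing \<open>s\<close>; its image has the wrong norm with probability at
  least \<open>2\<^sup>-\<^sup>8\<^sup>s\<close>, so by independence all vectors together with the origin are preserved with
  probability at most \<open>(1 - 2\<^sup>-\<^sup>8\<^sup>s)\<^sup>N\<^sup>-\<^sup>1\<close>. This forces \<open>s\<close> to be of order \<open>lg N\<close> once \<open>N\<close> is large in
  terms of \<open>p\<^sub>0\<close>.

  For bounded \<open>N\<close> a single vector must violate the hypothesis when \<open>\<epsilon> \<surd>m\<close> is tiny: for large \<open>m\<close>
  two columns at distance \<open>m\<close> turn the squared norm into a simple random walk of length \<open>m\<close>, and for
  bounded \<open>m\<close> many columns at distance \<open>m\<close> make every row a long random walk.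
\<close>

section \<open>Averages over random signs\<close>

text \<open>Moving a row and two columns by the same amount preserves both Toeplitz indices. So the
  products of Toeplitz entries that arise in one residue class of rows modulo \<open>s\<close>
  coincide often: their sum has variance of order \<open>s^2 * m\<close>, where distinct products
  would give only \<open>s * m\<close>. If each of the \<open>s\<close> classes reaches its standard
  deviation, the total is of order \<open>s^2 * sqrt m\<close>, against a mean squared norm of
  \<open>2 * s * m\<close>. This is a relative error of order \<open>s / sqrt m\<close>, hence the
  size of \<open>s\<close>. A comb has length about \<open>s * s\<close> and must fit into
  \<open>m\<close> columns, which is why \<epsilon> is bounded by the constant
  \<open>1 / 24\<close>.

  The bound on \<open>lg N\<close> so obtained has an additive loss that grows as
  \<open>p\<^sub>0\<close> tends to 0, so it says nothing about small \<open>N\<close>. There one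
  vector must fail with probability above \<open>1 - p\<^sub>0\<close>. Moment comparison cannot
  show this, since it only yields failure with a fixed small probability; the single-vector part
  therefore rests on upper bounds for the point probabilities of a walk.\<close>

definition signs :: "'i set \<Rightarrow> ('i \<Rightarrow> real) set" where
  "signs I = PiE_dflt I 0 (\<lambda>_. {-1, 1})"

text \<open>An expectation written as a finite sum, so that linearity and exchange of sums need no
  integrability.\<close>

definition sign_mean :: "'i set \<Rightarrow> (('i \<Rightarrow> real) \<Rightarrow> real) \<Rightarrow> real" where
  "sign_mean I f = (\<Sum>w\<in>signs I. f w) / 2 ^ card I"

text \<open>Quantifying over all functions, not only sign patterns, allows coordinates to be
  overwritten as in \<open>w(i := c)\<close> without checking membership in
  \<open>signs\<close>.\<close>

definition determined_by :: "'i set \<Rightarrow> (('i \<Rightarrow> real) \<Rightarrow> 'b) \<Rightarrow> bool" where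
  "determined_by A f \<longleftrightarrow> (\<forall>w w'. (\<forall>i\<in>A. w i = w' i) \<longrightarrow> f w = f w')"

lemma finite_signs: "finite I \<Longrightarrow> finite (signs I)"
  unfolding signs_def by (intro finite_PiE_dflt) auto

lemma card_signs: "finite I \<Longrightarrow> card (signs I) = 2 ^ card I"
  unfolding signs_def by (subst card_PiE_dflt) (auto simp: numeral_2_eq_2)

lemma signs_cases: "w \<in> signs I \<Longrightarrow> i \<in> I \<Longrightarrow> w i = 1 \<or> w i = -1"
  by (auto simp: signs_def PiE_dflt_def)

lemma signs_square: "w \<in> signs I \<Longrightarrow> i \<in> I \<Longrightarrow> (w i)\<^sup>2 = 1"
  using signs_cases by fastforce

lemma sign_mean_const: "finite I \<Longrightarrow> sign_mean I (\<lambda>_. c) = c"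
  by (simp add: sign_mean_def card_signs)

lemma sign_mean_add: "sign_mean I (\<lambda>w. f w + g w) = sign_mean I f + sign_mean I g"
  by (simp add: sign_mean_def sum.distrib add_divide_distrib)

lemma sign_mean_diff: "sign_mean I (\<lambda>w. f w - g w) = sign_mean I f - sign_mean I g"
  by (simp add: sign_mean_def sum_subtractf diff_divide_distrib)

lemma sign_mean_cmult: "sign_mean I (\<lambda>w. c * f w) = c * sign_mean I f"
  by (simp add: sign_mean_def sum_distrib_left)

lemma sign_mean_sum: "sign_mean I (\<lambda>w. \<Sum>k\<in>K. f k w) = (\<Sum>k\<in>K. sign_mean I (f k))"
  unfolding sign_mean_def by (subst sum.swap) (simp add: sum_divide_distrib)

lemma sign_mean_cong: "(\<And>w. w \<in> signs I \<Longrightarrow> f w = g w) \<Longrightarrow> sign_mean I f = sign_mean I g"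
  by (simp add: sign_mean_def)

lemma sign_mean_mono: "(\<And>w. w \<in> signs I \<Longrightarrow> f w \<le> g w) \<Longrightarrow> sign_mean I f \<le> sign_mean I g"
  by (simp add: sign_mean_def sum_mono divide_right_mono)

lemma sign_mean_nonneg: "(\<And>w. w \<in> signs I \<Longrightarrow> 0 \<le> f w) \<Longrightarrow> 0 \<le> sign_mean I f"
  by (simp add: sign_mean_def sum_nonneg)

text \<open>A product of uniform distributions is uniform on the product set, which turns
  probabilities into counts.\<close>

lemma measure_entries_pmf:
  "measure_pmf.prob (entries_pmf m n) S = sign_mean (entry_indices m n) (\<lambda>w. of_bool (w \<in> S))"
proof -
  let ?I = "entry_indices m n"
  have ne: "signs ?I \<noteq> {}"
    using card_signs[OF finite_entry_indices[of m n]] by (metis card.empty power_not_zero zero_neq_numeral)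
  have "entries_pmf m n = pmf_of_set (signs ?I)"
    unfolding entries_pmf_def rademacher_pmf_def signs_def
    by (rule Pi_pmf_of_set) (auto simp: finite_entry_indices)
  then have "measure_pmf.prob (entries_pmf m n) S = real (card (signs ?I \<inter> S)) / 2 ^ card ?I"
    using ne by (simp add: measure_pmf_of_set finite_signs card_signs finite_entry_indices)
  also have "\<dots> = sign_mean ?I (\<lambda>w. of_bool (w \<in> S))"
    by (simp add: sign_mean_def finite_signs finite_entry_indices Int_def)
  finally show ?thesis .
qed

lemma sign_mean_flip:
  assumes "B \<subseteq> I"
  shows "sign_mean I (\<lambda>w. f (\<lambda>i. if i \<in> B then - w i else w i)) = sign_mean I f"
proof -
  let ?F = "\<lambda>w i. if i \<in> B then - w i else (w i :: real)"
  have "(\<Sum>w\<in>signs I. f (?F w)) = (\<Sum>w\<in>signs I. f w)"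
    by (rule sum.reindex_bij_witness[of _ ?F ?F])
       (use assms in \<open>auto simp: signs_def PiE_dflt_def fun_eq_iff\<close>)
  then show ?thesis by (simp add: sign_mean_def)
qed

text \<open>Integrates out one coordinate: \<open>f\<close> is averaged with its copy under the flip
  of \<open>i\<close>. The inductions for independence, for the moments and for the walk peel off
  one sign at a time with it.\<close>

lemma sign_mean_average:
  assumes "i \<in> I"
  shows "sign_mean I f = sign_mean I (\<lambda>w. (f (w(i := 1)) + f (w(i := -1))) / 2)"
proof -
  have "sign_mean I f = sign_mean I (\<lambda>w. (1/2) * (f w + f (\<lambda>j. if j \<in> {i} then - w j else w j)))"
    unfolding sign_mean_cmult sign_mean_add using assms sign_mean_flip[of "{i}" I f] by simp
  also have "\<dots> = sign_mean I (\<lambda>w. (f (w(i := 1)) + f (w(i := -1))) / 2)"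
  proof (rule sign_mean_cong)
    fix w :: "'a \<Rightarrow> real" assume w: "w \<in> signs I"
    have fl: "(\<lambda>j. if j \<in> {i} then - w j else w j) = w(i := - w i)" by auto
    from signs_cases[OF w assms] show "(1/2) * (f w + f (\<lambda>j. if j \<in> {i} then - w j else w j))
        = (f (w(i := 1)) + f (w(i := -1))) / 2"
    proof
      assume "w i = 1"
      then show ?thesis unfolding fl using fun_upd_triv[of w i] by simp
    next
      assume "w i = -1"
      then show ?thesis unfolding fl using fun_upd_triv[of w i] by simp
    qed
  qed
  finally show ?thesis .
qed

section \<open>Independence of functions of disjoint sets of signs\<close>

lemma determined_byD: "determined_by A f \<Longrightarrow> (\<And>i. i \<in> A \<Longrightarrow> w i = w' i) \<Longrightarrow> f w = f w'"
  by (auto simp: determined_by_def)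

lemma determined_by_mono: "determined_by A f \<Longrightarrow> A \<subseteq> B \<Longrightarrow> determined_by B f"
  by (auto simp: determined_by_def)

lemma determined_by_upd: "determined_by A f \<Longrightarrow> i \<notin> A \<Longrightarrow> f (w(i := c)) = f w"
  by (rule determined_byD) auto

lemma determined_by_const [simp]: "determined_by A (\<lambda>_. c)"
  by (simp add: determined_by_def)

lemma determined_by_comp: "determined_by A f \<Longrightarrow> determined_by A (\<lambda>w. h (f w))"
  unfolding determined_by_def by metis

lemma determined_by_sum:
  "(\<And>k. k \<in> K \<Longrightarrow> determined_by A (f k)) \<Longrightarrow> determined_by A (\<lambda>w. \<Sum>k\<in>K. f k w)"
  unfolding determined_by_def by (auto intro!: sum.cong)

lemma determined_by_prod:
  "(\<And>k. k \<in> K \<Longrightarrow> determined_by A (f k)) \<Longrightarrow> determined_by A (\<lambda>w. \<Prod>k\<in>K. f k w)"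
  unfolding determined_by_def by (auto intro!: prod.cong)

text \<open>Averaging over one coordinate of \<open>A\<close> leaves \<open>g\<close> untouched and
  replaces \<open>f\<close> by a function of one coordinate less. When \<open>A\<close> is
  exhausted, \<open>f\<close> is constant and factors out.\<close>

lemma sign_mean_mult_indep:
  assumes I: "finite I" and A: "A \<subseteq> I" and AB: "A \<inter> B = {}"
    and f: "determined_by A f" and g: "determined_by B g"
  shows "sign_mean I (\<lambda>w. f w * g w) = sign_mean I f * sign_mean I g"
proof -
  have "finite A" using A I finite_subset by auto
  then show ?thesis using A AB f
  proof (induction A arbitrary: f)
    case empty
    then have "f = (\<lambda>_. f (\<lambda>_. 0))" unfolding determined_by_def by blast
    then obtain c where "f = (\<lambda>_. c)" by blast
    then show ?case using I by (simp add: sign_mean_cmult sign_mean_const)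
  next
    case (insert i A)
    define h where "h = (\<lambda>w. (f (w(i := 1)) + f (w(i := -1))) / 2)"
    have i: "i \<in> I" using insert by auto
    have fh: "sign_mean I f = sign_mean I h"
      unfolding h_def by (rule sign_mean_average[OF i])
    have "sign_mean I (\<lambda>w. f w * g w) = sign_mean I (\<lambda>w. h w * g w)"
    proof (subst sign_mean_average[OF i], rule sign_mean_cong)
      fix w :: "'a \<Rightarrow> real"
      have "g (w(i := c)) = g w" for c
        using insert.prems g by (intro determined_by_upd) auto
      then show "(f (w(i := 1)) * g (w(i := 1)) + f (w(i := - 1)) * g (w(i := - 1))) / 2 = h w * g w"
        by (simp add: h_def field_simps)
    qed
    also have "\<dots> = sign_mean I h * sign_mean I g"
    proof (rule insert.IH)
      show "determined_by A h"
        unfolding determined_by_def h_def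
      proof (intro allI impI)
        fix w w' :: "'a \<Rightarrow> real" assume eq: "\<forall>i\<in>A. w i = w' i"
        have "f (w(i := c)) = f (w'(i := c))" for c
          using eq by (intro determined_byD[OF insert.prems(3)]) auto
        then show "(f (w(i := 1)) + f (w(i := - 1))) / 2 = (f (w'(i := 1)) + f (w'(i := - 1))) / 2"
          by simp
      qed
    qed (use insert.prems in auto)
    finally show ?case by (simp add: fh)
  qed
qed

lemma sign_mean_prod_indep:
  assumes I: "finite I" and K: "finite K" and A: "\<And>k. k \<in> K \<Longrightarrow> A k \<subseteq> I"
    and disj: "disjoint_family_on A K"
    and f: "\<And>k. k \<in> K \<Longrightarrow> determined_by (A k) (f k)"
  shows "sign_mean I (\<lambda>w. \<Prod>k\<in>K. f k w) = (\<Prod>k\<in>K. sign_mean I (f k))"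
  using K A disj f
proof (induction K)
  case empty
  then show ?case using I by (simp add: sign_mean_const)
next
  case (insert k K)
  have "sign_mean I (\<lambda>w. f k w * (\<Prod>k\<in>K. f k w)) = sign_mean I (f k) * sign_mean I (\<lambda>w. \<Prod>k\<in>K. f k w)"
  proof (rule sign_mean_mult_indep[OF I, where A = "A k" and B = "\<Union>j\<in>K. A j"])
    have "A k \<inter> A j = {}" if "j \<in> K" for j
      using that insert.hyps(2) by (intro disjoint_family_onD[OF insert.prems(2)]) auto
    then show "A k \<inter> (\<Union>j\<in>K. A j) = {}" by auto
    show "determined_by (\<Union>j\<in>K. A j) (\<lambda>w. \<Prod>k\<in>K. f k w)"
      by (rule determined_by_prod, rule determined_by_mono[OF insert.prems(3)]) auto
    show "A k \<subseteq> I" using insert.prems(1) by auto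
    show "determined_by (A k) (f k)" using insert.prems(3) by auto
  qed
  also have "sign_mean I (\<lambda>w. \<Prod>k\<in>K. f k w) = (\<Prod>k\<in>K. sign_mean I (f k))"
  proof (rule insert.IH)
    show "disjoint_family_on A K" using insert.prems(2) by (auto simp: disjoint_family_on_def)
    show "A j \<subseteq> I" if "j \<in> K" for j using that insert.prems(1) by auto
    show "determined_by (A j) (f j)" if "j \<in> K" for j using that insert.prems(3) by auto
  qed
  finally show ?case using insert.hyps by simp
qed

lemma sign_mean_coords_fixed:
  assumes I: "finite I" and J: "J \<subseteq> I" and c: "\<And>j. j \<in> J \<Longrightarrow> c j = 1 \<or> c j = -1"
  shows "sign_mean I (\<lambda>w. of_bool (\<forall>j\<in>J. w j = c j)) = 1 / 2 ^ card J"
proof -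
  have fJ: "finite J" using I J finite_subset by auto
  have "sign_mean I (\<lambda>w. of_bool (\<forall>j\<in>J. w j = c j)) = sign_mean I (\<lambda>w. \<Prod>j\<in>J. of_bool (w j = c j))"
  proof (rule sign_mean_cong)
    fix w :: "'a \<Rightarrow> real"
    show "of_bool (\<forall>j\<in>J. w j = c j) = (\<Prod>j\<in>J. of_bool (w j = c j) :: real)"
      using fJ by (induction J rule: finite_induct) auto
  qed
  also have "\<dots> = (\<Prod>j\<in>J. sign_mean I (\<lambda>w. of_bool (w j = c j)))"
    by (rule sign_mean_prod_indep[where A = "\<lambda>j. {j}" and f = "\<lambda>j w. of_bool (w j = c j)"])
       (use I J fJ in \<open>auto simp: disjoint_family_on_def determined_by_def\<close>)
  also have "\<dots> = (\<Prod>j\<in>J. 1/2)"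
  proof (rule prod.cong[OF refl])
    fix j assume j: "j \<in> J"
    then have "j \<in> I" using J by auto
    from sign_mean_average[OF this, of "\<lambda>w. of_bool (w j = c j)"]
    have "sign_mean I (\<lambda>w. of_bool (w j = c j)) = sign_mean I (\<lambda>w. 1/2)"
      using c[OF j] by (auto intro!: sign_mean_cong)
    then show "sign_mean I (\<lambda>w. of_bool (w j = c j)) = 1/2"
      using I by (simp add: sign_mean_const)
  qed
  finally show ?thesis by (simp add: power_one_over)
qed

section \<open>Moments and anticoncentration of Rademacher forms\<close>

text \<open>The coefficients do not depend on the signs in \<open>B\<close>, so the cross terms
  average out one coordinate at a time. The weight \<open>g\<close> is there for the mixed terms in
  \<open>sign_mean_linear_fourth\<close>, where it is the square of a coefficient.\<close>

lemma sign_mean_linear_square: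
  assumes I: "finite I" and B: "B \<subseteq> I" and AB: "A \<inter> B = {}"
    and a: "\<And>l. l \<in> B \<Longrightarrow> determined_by A (a l)" and g: "determined_by A g"
  shows "sign_mean I (\<lambda>w. (\<Sum>l\<in>B. w l * a l w)\<^sup>2 * g w) = sign_mean I (\<lambda>w. (\<Sum>l\<in>B. (a l w)\<^sup>2) * g w)"
proof -
  have "finite B" using B I finite_subset by auto
  then show ?thesis using B AB a g
  proof (induction B arbitrary: g)
    case empty
    then show ?case by simp
  next
    case (insert i B)
    define S where "S = (\<lambda>w. \<Sum>l\<in>B. w l * a l w)"
    have iA: "i \<notin> A" and iI: "i \<in> I" using insert.prems by auto
    have al: "a l (w(i := c)) = a l w" if "l \<in> insert i B" for l w c
      using that iA insert.prems(3) determined_by_upd by metis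
    have gl: "g (w(i := c)) = g w" for w c
      using iA insert.prems(4) determined_by_upd by metis
    have Sl: "S (w(i := c)) = S w" for w c
      unfolding S_def using insert.hyps(2) al by (intro sum.cong) auto
    have eq: "(\<Sum>l\<in>insert i B. w l * a l w) = w i * a i w + S w" for w
      using insert.hyps by (simp add: S_def)
    have "sign_mean I (\<lambda>w. (w i * a i w + S w)\<^sup>2 * g w)
        = sign_mean I (\<lambda>w. (S w)\<^sup>2 * g w + (a i w)\<^sup>2 * g w)"
      by (subst sign_mean_average[OF iI], rule sign_mean_cong)
         (simp add: al gl Sl power2_eq_square algebra_simps)
    also have "\<dots> = sign_mean I (\<lambda>w. (\<Sum>l\<in>B. (a l w)\<^sup>2) * g w) + sign_mean I (\<lambda>w. (a i w)\<^sup>2 * g w)"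
      unfolding S_def sign_mean_add using insert.prems by (subst insert.IH) auto
    also have "\<dots> = sign_mean I (\<lambda>w. (\<Sum>l\<in>insert i B. (a l w)\<^sup>2) * g w)"
      using insert.hyps by (simp add: sign_mean_add[symmetric] algebra_simps)
    finally show ?case unfolding eq .
  qed
qed

text \<open>Khintchine's inequality with constant 3, conditional on \<open>A\<close>. A new term
  \<open>a\<close> turns \<open>S^4\<close> into \<open>S^4 + 6 * S^2 * a^2 + a^4\<close> on
  average, and \<open>3 * (T + a^2)^2\<close> has the same mixed term.\<close>

lemma sign_mean_linear_fourth:
  assumes I: "finite I" and B: "B \<subseteq> I" and AB: "A \<inter> B = {}"
    and a: "\<And>l. l \<in> B \<Longrightarrow> determined_by A (a l)"
  shows "sign_mean I (\<lambda>w. (\<Sum>l\<in>B. w l * a l w) ^ 4) \<le> 3 * sign_mean I (\<lambda>w. (\<Sum>l\<in>B. (a l w)\<^sup>2)\<^sup>2)"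
proof -
  have "finite B" using B I finite_subset by auto
  then show ?thesis using B AB a
  proof (induction B)
    case empty
    then show ?case using I by (simp add: sign_mean_const)
  next
    case (insert i B)
    define S where "S = (\<lambda>w. \<Sum>l\<in>B. w l * a l w)"
    define T where "T = (\<lambda>w. \<Sum>l\<in>B. (a l w)\<^sup>2)"
    have iA: "i \<notin> A" and iI: "i \<in> I" using insert.prems by auto
    have al: "a l (w(i := c)) = a l w" if "l \<in> insert i B" for l w c
      using that iA insert.prems(3) determined_by_upd by metis
    have Sl: "S (w(i := c)) = S w" for w c
      unfolding S_def using insert.hyps(2) al by (intro sum.cong) auto
    have eq: "(\<Sum>l\<in>insert i B. w l * a l w) = w i * a i w + S w"
      "(\<Sum>l\<in>insert i B. (a l w)\<^sup>2) = (a i w)\<^sup>2 + T w" for w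
      using insert.hyps by (simp_all add: S_def T_def)
    have "sign_mean I (\<lambda>w. (w i * a i w + S w) ^ 4)
        = sign_mean I (\<lambda>w. S w ^ 4 + (6 * ((S w)\<^sup>2 * (a i w)\<^sup>2) + a i w ^ 4))"
      by (subst sign_mean_average[OF iI], rule sign_mean_cong)
         (simp add: al Sl power2_eq_square power4_eq_xxxx algebra_simps)
    also have "\<dots> = sign_mean I (\<lambda>w. S w ^ 4)
        + (6 * sign_mean I (\<lambda>w. T w * (a i w)\<^sup>2) + sign_mean I (\<lambda>w. a i w ^ 4))"
    proof -
      have "sign_mean I (\<lambda>w. (S w)\<^sup>2 * (a i w)\<^sup>2) = sign_mean I (\<lambda>w. T w * (a i w)\<^sup>2)"
        unfolding S_def T_def
      proof (rule sign_mean_linear_square[OF I, where A = A])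
        show "determined_by A (\<lambda>w. (a i w)\<^sup>2)"
          using insert.prems(3)[of i] by (intro determined_by_comp[where h = "\<lambda>x. x\<^sup>2"]) auto
        show "determined_by A (a l)" if "l \<in> B" for l using that insert.prems(3) by auto
      qed (use insert.prems in auto)
      then show ?thesis unfolding sign_mean_add sign_mean_cmult by simp
    qed
    also have "\<dots> \<le> 3 * sign_mean I (\<lambda>w. (T w)\<^sup>2)
        + (6 * sign_mean I (\<lambda>w. T w * (a i w)\<^sup>2) + 3 * sign_mean I (\<lambda>w. a i w ^ 4))"
    proof -
      have "sign_mean I (\<lambda>w. S w ^ 4) \<le> 3 * sign_mean I (\<lambda>w. (T w)\<^sup>2)"
        unfolding S_def T_def using insert.prems by (intro insert.IH) auto
      moreover have "0 \<le> sign_mean I (\<lambda>w. a i w ^ 4)" by (rule sign_mean_nonneg) simp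
      ultimately show ?thesis by linarith
    qed
    also have "\<dots> = 3 * sign_mean I (\<lambda>w. ((a i w)\<^sup>2 + T w)\<^sup>2)"
      unfolding sign_mean_cmult[symmetric] sign_mean_add[symmetric]
      by (rule sign_mean_cong) (simp add: power2_eq_square power4_eq_xxxx algebra_simps)
    finally show ?case unfolding eq .
  qed
qed

lemma sign_mean_linear_form_square:
  assumes I: "finite I" and A: "A \<subseteq> I"
  shows "sign_mean I (\<lambda>w. (\<Sum>k\<in>A. M k * w k)\<^sup>2) = (\<Sum>k\<in>A. (M k)\<^sup>2)"
  using sign_mean_linear_square[OF I A, of "{}" "\<lambda>k _. M k" "\<lambda>_. 1"] I
  by (simp add: sign_mean_const mult.commute)

lemma sign_mean_norm_square:
  assumes I: "finite I" and A: "A \<subseteq> I"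
  shows "sign_mean I (\<lambda>w. \<Sum>l\<in>B. (\<Sum>k\<in>A. M k l * w k)\<^sup>2) = (\<Sum>k\<in>A. \<Sum>l\<in>B. (M k l)\<^sup>2)"
  by (subst sum.swap) (simp add: sign_mean_sum sign_mean_linear_form_square[OF assms])

text \<open>The vector-valued analogue. A new vector of squared length \<open>\<mu>\<close> brings
  in an inner product with contribution \<open>4 * D^2\<close>, at most \<open>4 * \<mu> * N\<close>
  by Cauchy-Schwarz; so the mixed term again has the factor 6.\<close>

lemma sign_mean_norm_fourth:
  fixes M :: "'i \<Rightarrow> 'j \<Rightarrow> real"
  assumes I: "finite I" and A: "A \<subseteq> I"
  shows "sign_mean I (\<lambda>w. (\<Sum>l\<in>B. (\<Sum>k\<in>A. M k l * w k)\<^sup>2)\<^sup>2) \<le> 3 * (\<Sum>k\<in>A. \<Sum>l\<in>B. (M k l)\<^sup>2)\<^sup>2"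
proof -
  have "finite A" using A I finite_subset by auto
  then show ?thesis using A
  proof (induction A)
    case empty
    then show ?case using I by (simp add: sign_mean_const)
  next
    case (insert i A)
    define v where "v = (\<lambda>w l. \<Sum>k\<in>A. M k l * w k)"
    define N where "N = (\<lambda>w. \<Sum>l\<in>B. (v w l)\<^sup>2)"
    define D where "D = (\<lambda>w. \<Sum>l\<in>B. v w l * M i l)"
    define \<mu> where "\<mu> = (\<Sum>l\<in>B. (M i l)\<^sup>2)"
    define X where "X = (\<Sum>k\<in>A. \<Sum>l\<in>B. (M k l)\<^sup>2)"
    have iI: "i \<in> I" using insert.prems by auto
    have v: "v (w(i := c)) l = v w l" for w c l
      unfolding v_def using insert.hyps(2) by (intro sum.cong) auto
    have eq: "(\<Sum>l\<in>B. (\<Sum>k\<in>insert i A. M k l * w k)\<^sup>2) = (\<Sum>l\<in>B. (v w l + M i l * w i)\<^sup>2)" for w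
      using insert.hyps by (simp add: v_def add.commute)
    have exp: "(\<Sum>l\<in>B. (v w l + M i l * c)\<^sup>2) = N w + 2 * c * D w + c\<^sup>2 * \<mu>" for w c
      by (simp add: N_def D_def \<mu>_def power2_eq_square algebra_simps sum.distrib sum_distrib_left)
    have "sign_mean I (\<lambda>w. (\<Sum>l\<in>B. (v w l + M i l * w i)\<^sup>2)\<^sup>2)
        = sign_mean I (\<lambda>w. (N w + \<mu>)\<^sup>2 + 4 * (D w)\<^sup>2)"
      by (subst sign_mean_average[OF iI], rule sign_mean_cong, simp only: v fun_upd_same exp)
         (simp add: power2_eq_square algebra_simps)
    also have "\<dots> \<le> sign_mean I (\<lambda>w. (N w)\<^sup>2 + (6 * \<mu> * N w + \<mu>\<^sup>2))"
    proof (rule sign_mean_mono)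
      fix w
      have "(D w)\<^sup>2 \<le> N w * \<mu>" unfolding D_def N_def \<mu>_def by (rule Cauchy_Schwarz_ineq_sum)
      then show "(N w + \<mu>)\<^sup>2 + 4 * (D w)\<^sup>2 \<le> (N w)\<^sup>2 + (6 * \<mu> * N w + \<mu>\<^sup>2)"
        by (simp add: power2_eq_square algebra_simps)
    qed
    also have "\<dots> = sign_mean I (\<lambda>w. (N w)\<^sup>2) + (6 * \<mu> * X + \<mu>\<^sup>2)"
      unfolding sign_mean_add sign_mean_cmult sign_mean_const[OF I] X_def N_def v_def
      using insert.prems by (subst sign_mean_norm_square[OF I]) auto
    also have "\<dots> \<le> 3 * X\<^sup>2 + (6 * \<mu> * X + 3 * \<mu>\<^sup>2)"
    proof -
      have "sign_mean I (\<lambda>w. (N w)\<^sup>2) \<le> 3 * X\<^sup>2"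
        using insert.IH insert.prems unfolding N_def v_def X_def by auto
      then show ?thesis using zero_le_power2[of \<mu>] by linarith
    qed
    also have "\<dots> = 3 * (X + \<mu>)\<^sup>2" by (simp add: power2_eq_square algebra_simps)
    finally show ?case unfolding eq using insert.hyps by (simp add: X_def \<mu>_def add.commute)
  qed
qed

text \<open>The quadratic on the right is at most 0 for \<open>Z < V / 4\<close> and at most 1 everywhere.\<close>

lemma paley_zygmund_pointwise:
  fixes Z V :: real
  assumes "V > 0" "Z \<ge> 0"
  shows "of_bool (Z \<ge> V / 4) \<ge> (Z - V / 4 - Z\<^sup>2 / (24 * V)) / (6 * V)"
proof (cases "Z \<ge> V / 4")
  case True
  \<comment> \<open>\<open>Z - Z^2 / (24 * V)\<close> is maximal at \<open>Z = 12 * V\<close> with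
    value \<open>6 * V\<close>, hence the normalising factor.\<close>
  have "0 \<le> (Z - 12 * V)\<^sup>2" by simp
  then have "24 * V * Z - Z\<^sup>2 \<le> 144 * V\<^sup>2" by (simp add: power2_eq_square algebra_simps)
  then have "(24 * V * Z - Z\<^sup>2) / (24 * V) \<le> 144 * V\<^sup>2 / (24 * V)"
    using assms by (intro divide_right_mono) auto
  then have "Z - Z\<^sup>2 / (24 * V) \<le> 6 * V"
    using assms by (simp add: diff_divide_distrib power2_eq_square)
  then show ?thesis using True assms by (simp add: divide_le_eq)
next
  case False
  moreover have "0 \<le> Z\<^sup>2 / (24 * V)" using assms by simp
  ultimately have "Z - V / 4 - Z\<^sup>2 / (24 * V) \<le> 0" by simp
  then show ?thesis using assms False by (simp add: divide_le_0_iff)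
qed

text \<open>Paley-Zygmund for the square of the form \<open>Q\<close>. Its mean is \<open>V\<close>
  and its second moment at most \<open>3 * 3 * V^2\<close>, one factor 3 for the signs in
  \<open>B\<close> and one for those in \<open>A\<close>. Hence the absolute value of
  \<open>Q\<close> reaches \<open>sqrt V / 2\<close> with probability at least
  \<open>1 / 16\<close>. Flipping the signs in \<open>B\<close> negates \<open>Q\<close>, so the
  upper tail has at least half of that.\<close>

lemma bilinear_anticoncentration:
  fixes M :: "'i \<Rightarrow> 'i \<Rightarrow> real"
  assumes I: "finite I" and A: "A \<subseteq> I" and B: "B \<subseteq> I" and AB: "A \<inter> B = {}"
    and V: "V = (\<Sum>k\<in>A. \<Sum>l\<in>B. (M k l)\<^sup>2)" "V > 0"
  shows "sign_mean I (\<lambda>w. of_bool ((\<Sum>k\<in>A. \<Sum>l\<in>B. M k l * w k * w l) \<ge> sqrt V / 2)) \<ge> 1 / 32"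
proof -
  define a where "a = (\<lambda>l w. \<Sum>k\<in>A. M k l * (w k :: real))"
  define Q where "Q = (\<lambda>w. \<Sum>l\<in>B. w l * a l w)"
  have Q: "(\<Sum>k\<in>A. \<Sum>l\<in>B. M k l * w k * w l) = Q w" for w
    unfolding Q_def a_def by (subst sum.swap) (simp add: sum_distrib_left algebra_simps)
  have a: "determined_by A (a l)" for l
    unfolding a_def by (rule determined_by_sum) (auto simp: determined_by_def)
  have Q2: "sign_mean I (\<lambda>w. (Q w)\<^sup>2) = V"
  proof -
    have "sign_mean I (\<lambda>w. (Q w)\<^sup>2 * 1) = sign_mean I (\<lambda>w. (\<Sum>l\<in>B. (a l w)\<^sup>2) * 1)"
      unfolding Q_def by (rule sign_mean_linear_square[OF I B AB a]) simp
    then show ?thesis unfolding V(1) using sign_mean_norm_square[OF I A, where M = M and B = B] by (simp add: a_def)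
  qed
  have Q4: "sign_mean I (\<lambda>w. (Q w) ^ 4) \<le> 9 * V\<^sup>2"
    using sign_mean_linear_fourth[OF I B AB, of a, OF a] sign_mean_norm_fourth[OF I A, where M = M and B = B]
    unfolding Q_def V(1) a_def by simp
  have "1 / 16 \<le> sign_mean I (\<lambda>w. (1 / (6 * V)) * ((Q w)\<^sup>2 - V / 4 - (1 / (24 * V)) * (Q w) ^ 4))"
  proof -
    have "(1 / (24 * V)) * sign_mean I (\<lambda>w. (Q w) ^ 4) \<le> (1 / (24 * V)) * (9 * V\<^sup>2)"
      using Q4 V(2) by (intro mult_left_mono) auto
    also have "\<dots> = 3 * V / 8" using V(2) by (simp add: power2_eq_square)
    finally have "3 * V / 8 \<le> V - V / 4 - (1 / (24 * V)) * sign_mean I (\<lambda>w. (Q w) ^ 4)" by simp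
    then have "(1 / (6 * V)) * (3 * V / 8) \<le> (1 / (6 * V)) * (V - V / 4 - (1 / (24 * V)) * sign_mean I (\<lambda>w. (Q w) ^ 4))"
      using V(2) by (intro mult_left_mono) auto
    moreover have "(1 / (6 * V)) * (3 * V / 8) = 1 / 16" using V(2) by simp
    ultimately show ?thesis
      unfolding sign_mean_cmult sign_mean_diff sign_mean_const[OF I] Q2 by linarith
  qed
  also have "\<dots> \<le> sign_mean I (\<lambda>w. of_bool (Q w \<ge> sqrt V / 2) + of_bool (- Q w \<ge> sqrt V / 2))"
  proof (rule sign_mean_mono)
    fix w
    have "(1 / (6 * V)) * ((Q w)\<^sup>2 - V / 4 - (1 / (24 * V)) * (Q w) ^ 4) \<le> of_bool ((Q w)\<^sup>2 \<ge> V / 4)"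
      using paley_zygmund_pointwise[OF V(2), of "(Q w)\<^sup>2"] by simp
    also have "\<dots> \<le> of_bool (Q w \<ge> sqrt V / 2) + of_bool (- Q w \<ge> sqrt V / 2)"
    proof -
      have "Q w \<ge> sqrt V / 2 \<or> - Q w \<ge> sqrt V / 2" if "(Q w)\<^sup>2 \<ge> V / 4"
      proof -
        have "sqrt (V / 4) \<le> \<bar>Q w\<bar>" using that real_le_rsqrt real_sqrt_le_iff real_sqrt_abs by metis
        then show ?thesis by (auto simp: real_sqrt_divide)
      qed
      then show ?thesis by auto
    qed
    finally show "(1 / (6 * V)) * ((Q w)\<^sup>2 - V / 4 - (1 / (24 * V)) * (Q w) ^ 4)
        \<le> of_bool (Q w \<ge> sqrt V / 2) + of_bool (- Q w \<ge> sqrt V / 2)" .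
  qed
  also have "\<dots> = 2 * sign_mean I (\<lambda>w. of_bool (Q w \<ge> sqrt V / 2))"
  proof -
    have fl: "Q (\<lambda>i. if i \<in> B then - w i else w i) = - Q w" for w
    proof -
      have "a l (\<lambda>i. if i \<in> B then - w i else w i) = a l w" for l
        unfolding a_def using AB by (intro sum.cong) auto
      then show ?thesis by (simp add: Q_def sum_negf)
    qed
    have "sign_mean I (\<lambda>w. of_bool (- Q w \<ge> sqrt V / 2)) = sign_mean I (\<lambda>w. of_bool (Q w \<ge> sqrt V / 2))"
      using sign_mean_flip[OF B, of "\<lambda>w. of_bool (Q w \<ge> sqrt V / 2)"] by (simp only: fl)
    then show ?thesis by (simp add: sign_mean_add)
  qed
  finally show ?thesis unfolding Q by simp
qed

text \<open>Terms with the same two coordinates add up before squaring, so the variance is the sum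
  of the squared multiplicities \<open>M a b\<close>, that is, the number of ordered pairs of
  coinciding terms. Any family \<open>P\<close> of such pairs bounds it from below.\<close>

lemma bilinear_sum_anticoncentration:
  assumes I: "finite I" and A: "A \<subseteq> I" and B: "B \<subseteq> I" and AB: "A \<inter> B = {}"
    and E: "finite E" "\<alpha> ` E \<subseteq> A" "\<beta> ` E \<subseteq> B"
    and P: "P \<subseteq> {(e, e'). e \<in> E \<and> e' \<in> E \<and> \<alpha> e = \<alpha> e' \<and> \<beta> e = \<beta> e'}"
    and V: "0 < V" "V \<le> real (card P)"
  shows "sign_mean I (\<lambda>w. of_bool ((\<Sum>e\<in>E. w (\<alpha> e) * w (\<beta> e)) \<ge> sqrt V / 2)) \<ge> 1 / 32"
proof -
  define fib where "fib = (\<lambda>a b. {e \<in> E. (\<alpha> e, \<beta> e) = (a, b)})"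
  define M where "M = (\<lambda>a b. real (card (fib a b)))"
  define V' where "V' = (\<Sum>a\<in>A. \<Sum>b\<in>B. (M a b)\<^sup>2)"
  have fin: "finite (A \<times> B)" using A B I by (meson finite_SigmaI finite_subset)
  have grp: "(\<Sum>a\<in>A. \<Sum>b\<in>B. sum f (fib a b)) = sum f E" for f :: "_ \<Rightarrow> real"
  proof -
    have "(\<Sum>p\<in>A \<times> B. sum f {e \<in> E. (\<alpha> e, \<beta> e) = p}) = sum f E"
      using E fin by (intro sum.group) auto
    then show ?thesis by (simp add: sum.cartesian_product fib_def case_prod_beta prod_eq_iff)
  qed
  have form: "(\<Sum>a\<in>A. \<Sum>b\<in>B. M a b * w a * w b) = (\<Sum>e\<in>E. w (\<alpha> e) * w (\<beta> e))" for w
  proof -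
    have "(\<Sum>a\<in>A. \<Sum>b\<in>B. M a b * w a * w b) = (\<Sum>a\<in>A. \<Sum>b\<in>B. \<Sum>e\<in>fib a b. w (\<alpha> e) * w (\<beta> e))"
    proof (intro sum.cong refl)
      fix a b
      have "(\<Sum>e\<in>fib a b. w (\<alpha> e) * w (\<beta> e)) = (\<Sum>e\<in>fib a b. w a * w b)"
        by (rule sum.cong) (auto simp: fib_def)
      then show "M a b * w a * w b = (\<Sum>e\<in>fib a b. w (\<alpha> e) * w (\<beta> e))" by (simp add: M_def)
    qed
    then show ?thesis by (simp only: grp)
  qed
  have "real (card P) \<le> V'"
  proof -
    have "P \<subseteq> (SIGMA e:E. fib (\<alpha> e) (\<beta> e))" using P by (auto simp: fib_def)
    then have "card P \<le> card (SIGMA e:E. fib (\<alpha> e) (\<beta> e))"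
      using E by (intro card_mono) (auto simp: fib_def)
    also have "\<dots> = (\<Sum>e\<in>E. card (fib (\<alpha> e) (\<beta> e)))"
      using E by (simp add: fib_def)
    finally have "real (card P) \<le> (\<Sum>e\<in>E. M (\<alpha> e) (\<beta> e))"
      unfolding M_def of_nat_sum[symmetric] of_nat_le_iff .
    also have "\<dots> = (\<Sum>a\<in>A. \<Sum>b\<in>B. \<Sum>e\<in>fib a b. M (\<alpha> e) (\<beta> e))" by (simp only: grp)
    also have "\<dots> = V'"
      unfolding V'_def
    proof (intro sum.cong refl)
      fix a b
      have "(\<Sum>e\<in>fib a b. M (\<alpha> e) (\<beta> e)) = (\<Sum>e\<in>fib a b. M a b)"
        by (rule sum.cong) (auto simp: fib_def)
      then show "(\<Sum>e\<in>fib a b. M (\<alpha> e) (\<beta> e)) = (M a b)\<^sup>2"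
        by (simp add: M_def power2_eq_square)
    qed
    finally show ?thesis .
  qed
  then have V': "V \<le> V'" "0 < V'" using V by auto
  have "1 / 32 \<le> sign_mean I (\<lambda>w. of_bool ((\<Sum>a\<in>A. \<Sum>b\<in>B. M a b * w a * w b) \<ge> sqrt V' / 2))"
    by (rule bilinear_anticoncentration[OF I A B AB V'_def V'(2)])
  also have "\<dots> \<le> sign_mean I (\<lambda>w. of_bool ((\<Sum>e\<in>E. w (\<alpha> e) * w (\<beta> e)) \<ge> sqrt V / 2))"
    unfolding form
  proof (rule sign_mean_mono)
    fix w
    have "sqrt V / 2 \<le> (\<Sum>e\<in>E. w (\<alpha> e) * w (\<beta> e))"
      if "sqrt V' / 2 \<le> (\<Sum>e\<in>E. w (\<alpha> e) * w (\<beta> e))"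
      using that real_sqrt_le_mono[OF V'(1)] by linarith
    then show "of_bool ((\<Sum>e\<in>E. w (\<alpha> e) * w (\<beta> e)) \<ge> sqrt V' / 2)
        \<le> (of_bool ((\<Sum>e\<in>E. w (\<alpha> e) * w (\<beta> e)) \<ge> sqrt V / 2) :: real)"
      by (simp only: of_bool_def split: if_split) simp
  qed
  finally show ?thesis .
qed

section \<open>Point probabilities of the simple random walk\<close>

text \<open>The square of the left side times \<open>2 * j + 1\<close> does not increase with
  \<open>j\<close>, because \<open>(2 * j + 1) * (2 * j + 3) \<le> (2 * j + 2)^2\<close>.\<close>

lemma central_binomial_le: "real ((2 * j) choose j) / 2 ^ (2 * j) \<le> 1 / sqrt (2 * j + 1)"
proof -
  define c where "c = (\<lambda>j. real ((2 * j) choose j) / 2 ^ (2 * j))"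
  have rec: "c (Suc j) = c j * (2 * j + 1) / (2 * j + 2)" for j
  proof -
    have "(Suc j) * (Suc (2 * j + 1) choose Suc j) = Suc (2 * j + 1) * ((2 * j + 1) choose j)"
      by (rule Suc_times_binomial)
    moreover have "(2 * j + 1) choose j = (2 * j + 1) choose Suc j"
      using binomial_symmetric[of j "2 * j + 1"] by simp
    moreover have "(Suc j) * (Suc (2 * j) choose Suc j) = Suc (2 * j) * ((2 * j) choose j)"
      by (rule Suc_times_binomial)
    ultimately have "(Suc j) * ((Suc j) * ((2 * Suc j) choose Suc j))
        = Suc (2 * j + 1) * (Suc (2 * j) * ((2 * j) choose j))"
      by (metis Suc_eq_plus1 add_Suc_right add_Suc mult.left_commute mult_2)
    then have "real ((Suc j) * ((Suc j) * ((2 * Suc j) choose Suc j)))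
        = real (Suc (2 * j + 1) * (Suc (2 * j) * ((2 * j) choose j)))" by (rule arg_cong)
    then have "(real j + 1) * ((real j + 1) * real ((2 * Suc j) choose Suc j))
        = (real j + 1) * (2 * (2 * j + 1) * real ((2 * j) choose j))"
      by (simp add: algebra_simps)
    then have "(real j + 1) * real ((2 * Suc j) choose Suc j) = 2 * (2 * j + 1) * real ((2 * j) choose j)"
      by (simp only: mult_cancel_left) auto
    then have "real ((2 * Suc j) choose Suc j) = 2 * (2 * j + 1) * real ((2 * j) choose j) / (real j + 1)"
      by (simp add: eq_divide_eq mult.commute)
    then have "c (Suc j) = 2 * (2 * j + 1) * real ((2 * j) choose j) / (real j + 1) / 2 ^ (2 * Suc j)"
      by (simp only: c_def)
    moreover have "2 * (2 * x + 1) * y / (x + 1) / (4 * p) = y / p * (2 * x + 1) / (2 * x + 2)"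
      if "x \<ge> 0" "p > 0" for x y p :: real
      using that by (simp add: divide_simps) (simp add: algebra_simps)
    from this[of "real j" "2 ^ (2 * j)" "real ((2 * j) choose j)"]
    have "2 * (2 * j + 1) * real ((2 * j) choose j) / (real j + 1) / 2 ^ (2 * Suc j)
        = c j * (2 * j + 1) / (2 * j + 2)" by (simp add: c_def add_ac)
    ultimately show ?thesis by simp
  qed
  have sq: "(c j)\<^sup>2 * (2 * j + 1) \<le> 1" for j
  proof (induction j)
    case 0
    show ?case by (simp add: c_def)
  next
    case (Suc j)
    have "(c (Suc j))\<^sup>2 * (2 * Suc j + 1)
        = ((c j)\<^sup>2 * (2 * j + 1)) * ((2 * real j + 1) * (2 * real j + 3) / (2 * real j + 2)\<^sup>2)"
    proof -
      have "(x * a / b)\<^sup>2 * d = (x\<^sup>2 * a) * (a * d / b\<^sup>2)" for x a b d :: real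
        by (simp add: power_mult_distrib power_divide power2_eq_square)
      from this[of "c j" "2 * real j + 1" "2 * real j + 2" "2 * real j + 3"]
      show ?thesis by (simp add: rec add_ac)
    qed
    also have "\<dots> \<le> 1 * 1"
    proof (rule mult_mono[OF Suc.IH])
      have "(2 * real j + 1) * (2 * real j + 3) \<le> (2 * real j + 2)\<^sup>2" by (simp add: power2_eq_square algebra_simps)
      then show "(2 * real j + 1) * (2 * real j + 3) / (2 * real j + 2)\<^sup>2 \<le> 1"
        by (simp add: divide_le_eq_1)
    qed auto
    finally show ?case by simp
  qed
  have "c j * sqrt (2 * j + 1) \<le> 1"
  proof (rule power2_le_imp_le)
    show "(c j * sqrt (2 * j + 1))\<^sup>2 \<le> 1\<^sup>2" using sq[of j] by (simp add: power_mult_distrib)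
  qed simp
  then have "c j \<le> 1 / sqrt (2 * j + 1)" by (simp add: pos_le_divide_eq)
  then show ?thesis unfolding c_def by simp
qed

lemma binomial_le_inverse_sqrt:
  assumes "n \<ge> 1"
  shows "real (n choose k) / 2 ^ n \<le> 1 / sqrt n"
proof -
  have "real (n choose k) / 2 ^ n \<le> real (n choose (n div 2)) / 2 ^ n"
    by (intro divide_right_mono) (auto simp: binomial_maximum)
  also have "\<dots> \<le> 1 / sqrt n"
  proof (cases "even n")
    case True
    then obtain j where j: "n = 2 * j" by auto
    have "real (n choose (n div 2)) / 2 ^ n \<le> 1 / sqrt (2 * j + 1)"
      using central_binomial_le[of j] by (simp add: j)
    also have "\<dots> \<le> 1 / sqrt n" using assms by (intro divide_left_mono) (auto simp: j)
    finally show ?thesis .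
  next
    case False
    then obtain j where j: "n = 2 * j + 1" by (auto elim: oddE)
    \<comment> \<open>In an odd row the middle coefficient is half the central one of the next
      row.\<close>
    have "(2 * Suc j) choose Suc j = 2 * (n choose (n div 2))"
      using binomial_symmetric[of j "2 * j + 1"] by (simp add: j)
    then have "real (n choose (n div 2)) / 2 ^ n = real ((2 * Suc j) choose Suc j) / 2 ^ (2 * Suc j)"
      by (simp add: j)
    also have "\<dots> \<le> 1 / sqrt (2 * Suc j + 1)" by (rule central_binomial_le)
    also have "\<dots> \<le> 1 / sqrt n" by (intro divide_left_mono) (auto simp: j)
    finally show ?thesis .
  qed
  finally show ?thesis .
qed

text \<open>The distribution of a sum of \<open>n\<close> independent signs. Real arguments admit
  targets computed from other random signs; values off the lattice get probability 0.\<close>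

fun walk_prob :: "nat \<Rightarrow> real \<Rightarrow> real" where
  "walk_prob 0 v = of_bool (v = 0)"
| "walk_prob (Suc n) v = (walk_prob n (v - 1) + walk_prob n (v + 1)) / 2"

text \<open>\<open>k\<close> counts the steps \<open>+1\<close>, and the recursion is Pascal's rule.
  An integer \<open>k\<close> covers the boundary case in which \<open>k - 1\<close> is
  negative.\<close>

lemma walk_prob_lattice:
  "walk_prob n (2 * real_of_int k - real n) = (if k < 0 then 0 else real (n choose nat k) / 2 ^ n)"
proof (induction n arbitrary: k)
  case 0
  show ?case by (cases "nat k") auto
next
  case (Suc n)
  have "2 * real_of_int k - real (Suc n) - 1 = 2 * real_of_int (k - 1) - real n"
    "2 * real_of_int k - real (Suc n) + 1 = 2 * real_of_int k - real n" by auto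
  then have "walk_prob (Suc n) (2 * real_of_int k - real (Suc n))
      = (walk_prob n (2 * real_of_int (k - 1) - real n) + walk_prob n (2 * real_of_int k - real n)) / 2"
    by (simp only: walk_prob.simps)
  also have "\<dots> = (if k < 0 then 0 else real (Suc n choose nat k) / 2 ^ Suc n)"
  proof (cases "k \<le> 0")
    case True
    then show ?thesis using Suc.IH[of "k - 1"] Suc.IH[of k] by auto
  next
    case False
    then have "nat k = Suc (nat (k - 1))" by simp
    then show ?thesis using False Suc.IH[of "k - 1"] Suc.IH[of k] by (simp add: field_simps)
  qed
  finally show ?case .
qed

lemma walk_prob_off_lattice: "(\<And>k. v \<noteq> 2 * real_of_int k - real n) \<Longrightarrow> walk_prob n v = 0"
proof (induction n arbitrary: v)
  case 0
  show ?case using "0"[of 0] by simp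
next
  case (Suc n)
  have "v - 1 \<noteq> 2 * real_of_int k - real n" "v + 1 \<noteq> 2 * real_of_int k - real n" for k
    using Suc.prems[of "k + 1"] Suc.prems[of k] by auto
  then show ?case by (simp add: Suc.IH)
qed

lemma walk_prob_le:
  assumes "n \<ge> 1"
  shows "walk_prob n v \<le> 1 / sqrt n"
proof (cases "\<exists>k. v = 2 * real_of_int k - real n")
  case True
  then show ?thesis using binomial_le_inverse_sqrt[OF assms] by (auto simp: walk_prob_lattice)
next
  case False
  then have "walk_prob n v = 0" by (intro walk_prob_off_lattice) auto
  then show ?thesis by simp
qed

text \<open>Given the signs in \<open>A\<close>, the terms \<open>w l * e l w\<close> are again
  independent signs and the target is fixed. Averaging over one term moves the target by 1 in either
  direction, as in the recursion of \<open>walk_prob\<close>.\<close>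

lemma sign_sum_point_prob:
  assumes I: "finite I" and B: "B \<subseteq> I" and AB: "A \<inter> B = {}"
    and e: "\<And>l. l \<in> B \<Longrightarrow> determined_by A (e l)" and v: "determined_by A v"
    and e1: "\<And>l w. l \<in> B \<Longrightarrow> w \<in> signs I \<Longrightarrow> e l w = 1 \<or> e l w = -1"
  shows "sign_mean I (\<lambda>w. of_bool ((\<Sum>l\<in>B. w l * e l w) = v w)) = sign_mean I (\<lambda>w. walk_prob (card B) (v w))"
proof -
  have "finite B" using B I finite_subset by auto
  then show ?thesis using B AB e v e1
  proof (induction B arbitrary: v)
    case empty
    then show ?case by (auto intro: sign_mean_cong)
  next
    case (insert i B)
    define S where "S = (\<lambda>w. \<Sum>l\<in>B. w l * e l w)"
    have iA: "i \<notin> A" and iI: "i \<in> I" using insert.prems by auto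
    have el: "e l (w(i := c)) = e l w" if "l \<in> insert i B" for l w c
      using that iA insert.prems(3) determined_by_upd by metis
    have vl: "v (w(i := c)) = v w" for w c
      using iA insert.prems(4) determined_by_upd by metis
    have Sl: "S (w(i := c)) = S w" for w c
      unfolding S_def using insert.hyps(2) el by (intro sum.cong) auto
    have eq: "(\<Sum>l\<in>insert i B. w l * e l w) = w i * e i w + S w" for w
      using insert.hyps by (simp add: S_def)
    have IH: "sign_mean I (\<lambda>w. of_bool (S w = v' w)) = sign_mean I (\<lambda>w. walk_prob (card B) (v' w))"
      if "determined_by A v'" for v'
      unfolding S_def using insert.prems that by (intro insert.IH) auto
    have "sign_mean I (\<lambda>w. of_bool (w i * e i w + S w = v w))
        = sign_mean I (\<lambda>w. (1/2) * (of_bool (S w = v w - 1) + of_bool (S w = v w + 1)))"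
    proof (subst sign_mean_average[OF iI], rule sign_mean_cong)
      fix w :: "'a \<Rightarrow> real" assume w: "w \<in> signs I"
      have "e i w = 1 \<or> e i w = -1" using insert.prems(5)[of i w] w by auto
      then show "(of_bool ((w(i := 1)) i * e i (w(i := 1)) + S (w(i := 1)) = v (w(i := 1)))
          + of_bool ((w(i := - 1)) i * e i (w(i := - 1)) + S (w(i := - 1)) = v (w(i := - 1)))) / 2
          = (1/2) * (of_bool (S w = v w - 1) + of_bool (S w = v w + 1) :: real)"
        by (auto simp: el vl Sl)
    qed
    also have "\<dots> = sign_mean I (\<lambda>w. (1/2) * (walk_prob (card B) (v w - 1) + walk_prob (card B) (v w + 1)))"
      unfolding sign_mean_cmult sign_mean_add
      using IH[of "\<lambda>w. v w - 1"] IH[of "\<lambda>w. v w + 1"] insert.prems(4)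
        determined_by_comp[of A v "\<lambda>x. x - 1"] determined_by_comp[of A v "\<lambda>x. x + 1"] by simp
    finally show ?case unfolding eq using insert.hyps by simp
  qed
qed

text \<open>The sum is an integer, and an interval of length \<open>2 * h\<close> contains at most
  \<open>2 * h + 1\<close> integers, each hit with probability at most
  \<open>1 / sqrt (card B)\<close>. The \<open>v j\<close> list the candidates upwards from the left
  end of the interval.\<close>

lemma sign_sum_anticoncentration:
  assumes I: "finite I" and B: "B \<subseteq> I" "B \<noteq> {}" and AB: "A \<inter> B = {}"
    and e: "\<And>l. l \<in> B \<Longrightarrow> determined_by A (e l)" and c: "determined_by A c"
    and e1: "\<And>l w. l \<in> B \<Longrightarrow> w \<in> signs I \<Longrightarrow> e l w = 1 \<or> e l w = -1"
    and h: "h \<ge> 0"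
  shows "sign_mean I (\<lambda>w. of_bool (\<bar>(\<Sum>l\<in>B. w l * e l w) - c w\<bar> \<le> h)) \<le> (2 * h + 1) / sqrt (card B)"
proof -
  define S where "S = (\<lambda>w. \<Sum>l\<in>B. w l * e l w)"
  define v where "v = (\<lambda>j w. real_of_int \<lceil>c w - h\<rceil> + real j)"
  define K where "K = nat \<lfloor>2 * h\<rfloor>"
  have fB: "finite B" using B I finite_subset by auto
  then have cB: "card B \<ge> 1" using B by (simp add: Suc_leI card_gt_0_iff)
  have "sign_mean I (\<lambda>w. of_bool (\<bar>S w - c w\<bar> \<le> h)) \<le> sign_mean I (\<lambda>w. \<Sum>j\<le>K. of_bool (S w = v j w))"
  proof (rule sign_mean_mono)
    fix w assume w: "w \<in> signs I"
    have "S w \<in> \<int>" unfolding S_def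
    proof (rule Ints_sum)
      fix l assume l: "l \<in> B"
      then have "w l = 1 \<or> w l = -1" using signs_cases[OF w] B by auto
      then show "w l * e l w \<in> \<int>" using e1[OF l w] by auto
    qed
    then obtain z where z: "S w = of_int z" by (auto elim: Ints_cases)
    show "of_bool (\<bar>S w - c w\<bar> \<le> h) \<le> (\<Sum>j\<le>K. of_bool (S w = v j w) :: real)"
    proof (cases "\<bar>S w - c w\<bar> \<le> h")
      case True
      define j where "j = nat (z - \<lceil>c w - h\<rceil>)"
      have "\<lceil>c w - h\<rceil> \<le> z" using True z by (simp add: ceiling_le_iff abs_le_iff)
      then have jz: "int j = z - \<lceil>c w - h\<rceil>" by (simp add: j_def)
      have "real_of_int (z - \<lceil>c w - h\<rceil>) \<le> 2 * h" using True z by (simp add: abs_le_iff) linarith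
      then have "z - \<lceil>c w - h\<rceil> \<le> \<lfloor>2 * h\<rfloor>" by (simp add: le_floor_iff)
      then have jK: "j \<le> K" using jz by (simp add: K_def)
      have "S w = v j w"
        unfolding v_def z using jz by (metis add.commute diff_add_cancel of_int_add of_int_of_nat_eq)
      then have "1 \<le> (\<Sum>j\<in>{j}. of_bool (S w = v j w) :: real)" by simp
      also have "\<dots> \<le> (\<Sum>j\<le>K. of_bool (S w = v j w))" using jK by (intro sum_mono2) auto
      finally show ?thesis using True by simp
    qed (simp add: sum_nonneg)
  qed
  also have "\<dots> = (\<Sum>j\<le>K. sign_mean I (\<lambda>w. walk_prob (card B) (v j w)))"
    unfolding sign_mean_sum S_def
  proof (rule sum.cong[OF refl], rule sign_sum_point_prob[OF I B(1) AB e])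
    show "determined_by A (v j)" for j
      unfolding v_def using determined_by_comp[OF c, of "\<lambda>x. real_of_int \<lceil>x - h\<rceil> + real j"] by simp
  qed (use e1 in auto)
  also have "\<dots> \<le> (\<Sum>j\<le>K. sign_mean I (\<lambda>_. 1 / sqrt (card B)))"
    using walk_prob_le[OF cB] by (intro sum_mono sign_mean_mono) auto
  also have "\<dots> = (real K + 1) / sqrt (card B)" using I by (simp add: sign_mean_const)
  also have "\<dots> \<le> (2 * h + 1) / sqrt (card B)"
    using h by (intro divide_right_mono) (auto simp: K_def)
  finally show ?thesis unfolding S_def .
qed

section \<open>Vectors supported on two combs\<close>

text \<open>Coordinate \<open>i\<close> of the image under \<open>TD\<close> of the indicator vector
  of \<open>J\<close>; \<open>j + 1\<close> is the index shift of the diagonal.\<close>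

definition row_sum :: "nat set \<Rightarrow> (int + nat \<Rightarrow> real) \<Rightarrow> nat \<Rightarrow> real" where
  "row_sum J w i = (\<Sum>j\<in>J. w (Inl (int j - int i)) * w (Inr (j + 1)))"

text \<open>Failure of the norm condition for the indicator vector of \<open>J\<close> against the
  origin, multiplied by \<open>m\<close> to clear the scaling of the matrix.\<close>

definition distorted :: "nat \<Rightarrow> real \<Rightarrow> nat set \<Rightarrow> (int + nat \<Rightarrow> real) \<Rightarrow> bool" where
  "distorted m \<epsilon> J w \<longleftrightarrow> \<bar>(\<Sum>i<m. (row_sum J w i)\<^sup>2) - real m * real (card J)\<bar> > \<epsilon> * (real m * real (card J))"

definition comb :: "nat \<Rightarrow> nat \<Rightarrow> nat set" where
  "comb c s = (\<lambda>k. c + k * s) ` {..<s}"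

lemma sum_comb: "s \<ge> 1 \<Longrightarrow> (\<Sum>j\<in>comb c s. f j) = (\<Sum>k<s. f (c + k * s))"
  unfolding comb_def by (subst sum.reindex) (auto simp: inj_on_def)

lemma card_comb: "s \<ge> 1 \<Longrightarrow> card (comb c s) = s"
  unfolding comb_def by (subst card_image) (auto simp: inj_on_def)

lemma comb_bounds:
  assumes "s * s \<le> m" "j \<in> comb c s"
  shows "c \<le> j" "j + s \<le> c + m"
proof -
  from assms obtain k where k: "k < s" "j = c + k * s" by (auto simp: comb_def)
  then have "Suc k * s \<le> s * s" by (intro mult_le_mono1) auto
  then show "c \<le> j" "j + s \<le> c + m" using k assms by auto
qed

text \<open>
  The pairs \<open>(e, e')\<close> are those where \<open>e'\<close> arises from \<open>e\<close> by moving the row down by \<open>d * s\<close>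
  and both columns right by \<open>d * s\<close>, with \<open>d \<le> s / 2\<close>; this keeps both Toeplitz indices.
\<close>

lemma coincidence_count:
  fixes m s \<rho> c c' :: nat
  assumes s: "s \<ge> 1" "s * s \<le> m" and \<rho>: "\<rho> < s"
  defines "E \<equiv> {(i, k, l). i < m \<and> i mod s = \<rho> \<and> k < s \<and> l < (s::nat)}"
  defines "\<alpha> \<equiv> \<lambda>(i, k, l). Inl (int (c + k * s) - int i) :: int + nat"
  defines "\<beta> \<equiv> \<lambda>(i, k, l). Inl (int (c' + l * s) - int i) :: int + nat"
  shows "\<exists>P \<subseteq> {(e, e'). e \<in> E \<and> e' \<in> E \<and> \<alpha> e = \<alpha> e' \<and> \<beta> e = \<beta> e'}.
    real s ^ 2 * m / 32 \<le> real (card P)"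
proof -
  \<comment> \<open>With shifts up to half of \<open>s\<close>, a constant fraction of the rows and
    columns keep their shifted copies in range.\<close>
  define z where "z = s div 2"
  define L where "L = m div s"
  have L: "s \<le> L" "m < s * (L + 1)" "s * L \<le> m" using s
    by (auto simp: L_def less_eq_div_iff_mult_less_eq dividend_less_times_div)
  define F where "F = (\<lambda>(q, d, k, l). ((\<rho> + q * s, k, l), (\<rho> + (q + d) * s, k + d, l + d)))"
  define S where "S = {..<L - z} \<times> {..z} \<times> {..<s - z} \<times> {..<s - z}"
  have row: "\<rho> + r * s < m" if "r < L" for r
  proof -
    have "\<rho> + r * s < Suc r * s" using \<rho> by simp
    also have "\<dots> \<le> L * s" using that by (intro mult_le_mono1) auto
    finally show ?thesis using L(3) by (simp add: mult.commute)
  qed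
  have "F ` S \<subseteq> {(e, e'). e \<in> E \<and> e' \<in> E \<and> \<alpha> e = \<alpha> e' \<and> \<beta> e = \<beta> e'}"
  proof
    fix x assume "x \<in> F ` S"
    then obtain q d k l where x: "x = ((\<rho> + q * s, k, l), (\<rho> + (q + d) * s, k + d, l + d))"
      and b: "q < L - z" "d \<le> z" "k < s - z" "l < s - z" by (auto simp: F_def S_def)
    have "q < L" "q + d < L" "k < s" "l < s" "k + d < s" "l + d < s" using b by auto
    then have "(\<rho> + q * s, k, l) \<in> E" "(\<rho> + (q + d) * s, k + d, l + d) \<in> E"
      using row[of q] row[of "q + d"] \<rho> by (simp_all add: E_def)
    then show "x \<in> {(e, e'). e \<in> E \<and> e' \<in> E \<and> \<alpha> e = \<alpha> e' \<and> \<beta> e = \<beta> e'}"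
      unfolding x by (simp add: \<alpha>_def \<beta>_def algebra_simps)
  qed
  moreover have "real s ^ 2 * m / 32 \<le> real (card (F ` S))"
  proof -
    have "inj_on F S"
    proof (rule inj_onI)
      fix x y assume xy: "x \<in> S" "y \<in> S" "F x = F y"
      obtain q d k l where x: "x = (q, d, k, l)" by (cases x)
      obtain q' d' k' l' where y: "y = (q', d', k', l')" by (cases y)
      from xy(3) have "\<rho> + q * s = \<rho> + q' * s" "k = k'" "l = l'" "k + d = k' + d'"
        by (auto simp: F_def x y)
      then show "x = y" using s by (auto simp: x y)
    qed
    then have "card (F ` S) = (L - z) * ((z + 1) * ((s - z) * (s - z)))"
      by (simp add: card_image S_def card_cartesian_product)
    then have card: "real (card (F ` S)) = real (L - z) * (real (z + 1) * (real (s - z) * real (s - z)))"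
      by (simp only: of_nat_mult)
    have z: "2 * z \<le> s" "s \<le> 2 * z + 1" by (auto simp: z_def)
    have sz: "real s / 2 \<le> real (s - z)" "real s / 2 \<le> real (z + 1)" using z by auto
    \<comment> \<open>At most half of the \<open>L\<close> rows counted are lost, since
      \<open>2 * z \<le> s \<le> L\<close>; the second inequality is where
      \<open>s * s \<le> m\<close> enters.\<close>
    have Lz: "real m / (4 * s) \<le> real (L - z)"
    proof -
      have "s * (L + 1) \<le> s * (2 * L)" using L s by (intro mult_le_mono2) auto
      then have "m \<le> s * (2 * L)" using L by linarith
      also have "\<dots> \<le> s * (2 * (2 * (L - z)))" using z L by (intro mult_le_mono2) auto
      finally have "real m \<le> real (s * (2 * (2 * (L - z))))" by (rule of_nat_mono)
      also have "\<dots> = 4 * s * real (L - z)" by simp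
      finally show ?thesis using s by (simp add: divide_le_eq mult_ac)
    qed
    \<comment> \<open>The factors count rows, shifts and the two columns, which gives
      \<open>32 = 4 * 2 * 2 * 2\<close>.\<close>
    have "real s ^ 2 * m / 32 = real m / (4 * s) * (real s / 2 * (real s / 2 * (real s / 2)))"
      using s by (simp add: power2_eq_square)
    also have "\<dots> \<le> real (L - z) * (real (z + 1) * (real (s - z) * real (s - z)))"
      using sz Lz by (intro mult_mono) auto
    finally show ?thesis unfolding card .
  qed
  ultimately show ?thesis by blast
qed

text \<open>
  If the signs of \<open>D\<close> are 1 on the first comb and \<open>\<sigma>\<close> on the second one, the squared norm exceeds
  its mean by \<open>base + 2 * \<sigma> * (\<Sum>\<rho><s. R \<rho>)\<close>, where \<open>R \<rho>\<close> collects the rows congruent to \<open>\<rho>\<close> modulo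
  \<open>s\<close>. The \<open>R \<rho>\<close> involve disjoint sets of Toeplitz entries, so they are all large simultaneously
  with probability exponential in \<open>s\<close> only, and then a suitable choice of \<open>\<sigma>\<close>, which is
  independent of the Toeplitz entries, pushes the norm away from its mean.
\<close>

lemma distortion_prob:
  fixes m n s c0 :: nat
  assumes s: "s \<ge> 1" "s * s \<le> m" and n: "c0 + 3 * m \<le> n" and \<epsilon>: "0 < \<epsilon>" "12 * \<epsilon> * sqrt m < s"
  defines "J \<equiv> comb c0 s \<union> comb (c0 + 2 * m) s"
  shows "sign_mean (entry_indices m n) (\<lambda>w. of_bool (distorted m \<epsilon> J w)) \<ge> 1 / 2 ^ (8 * s)"
proof -
  define I where "I = entry_indices m n"
  have fI: "finite I" by (simp add: I_def finite_entry_indices)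
  have m: "m \<ge> 1" using s by (metis le_trans mult_le_mono nat_mult_1)
  define E where "E = (\<lambda>\<rho>. {(i, k, l). i < m \<and> i mod s = \<rho> \<and> k < s \<and> l < (s::nat)})"
  define \<alpha> where "\<alpha> = (\<lambda>(i, k, l::nat). Inl (int (c0 + k * s) - int i) :: int + nat)"
  define \<beta> where "\<beta> = (\<lambda>(i, k::nat, l). Inl (int (c0 + 2 * m + l * s) - int i) :: int + nat)"
  define R where "R = (\<lambda>\<rho> w. \<Sum>e\<in>E \<rho>. w (\<alpha> e) * w (\<beta> e) :: real)"
  define V where "V = real s ^ 2 * m / 32"
  define \<theta> where "\<theta> = sqrt V / 2"
  have V: "0 < V" using s m by (simp add: V_def)
  have ks: "k * s + s \<le> m" if "k < s" for k
  proof -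
    have "Suc k * s \<le> s * s" using that by (intro mult_le_mono1) auto
    then show ?thesis using s by simp
  qed
  have finE: "finite (E \<rho>)" for \<rho>
    by (rule finite_subset[of _ "{..<m} \<times> {..<s} \<times> {..<s}"]) (auto simp: E_def)
  have Inl_I: "Inl x \<in> I \<longleftrightarrow> - int m < x \<and> x < int n" for x
    by (auto simp: I_def entry_indices_def)
  have Inr_I: "Inr x \<in> I \<longleftrightarrow> 1 \<le> x \<and> x \<le> n" for x
    by (auto simp: I_def entry_indices_def)
  have \<alpha>I: "\<alpha> ` E \<rho> \<subseteq> I" for \<rho>
  proof -
    have "\<alpha> (i, k, l) \<in> I" if "i < m" "k < s" for i k l
      using ks[OF that(2)] that n s by (auto simp: \<alpha>_def Inl_I simp flip: of_nat_mult)
    then show ?thesis by (auto simp: E_def)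
  qed
  have \<beta>I: "\<beta> ` E \<rho> \<subseteq> I" for \<rho>
  proof -
    have "\<beta> (i, k, l) \<in> I" if "i < m" "l < s" for i k l
      using ks[OF that(2)] that n s by (auto simp: \<beta>_def Inl_I simp flip: of_nat_mult)
    then show ?thesis by (auto simp: E_def)
  qed
  \<comment> \<open>The first comb meets only Toeplitz indices below \<open>c0 + m\<close>, the
    second only indices above it; hence the distance \<open>2 * m\<close> between their
    starts.\<close>
  have \<alpha>\<beta>: "\<alpha> e \<noteq> \<beta> e'" if "e \<in> E \<rho>" "e' \<in> E \<rho>'" for e e' \<rho> \<rho>'
  proof -
    obtain i k l i' k' l' where e: "e = (i, k, l)" "e' = (i', k', l')" by (cases e, cases e')
    then have "k < s" "i' < m" using that by (auto simp: E_def)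
    then have "c0 + k * s < c0 + m" "i' + m < 2 * m + l' * s" using ks[of k] s by auto
    then have "int (c0 + k * s) - int i < int (c0 + 2 * m + l' * s) - int i'" by linarith
    then show ?thesis by (simp add: e \<alpha>_def \<beta>_def)
  qed
  \<comment> \<open>The teeth of one comb are congruent modulo \<open>s\<close>, so an index met by
    that comb determines its row modulo \<open>s\<close>.\<close>
  have cls: "\<rho> = \<rho>'" if "e \<in> E \<rho>" "e' \<in> E \<rho>'" "\<alpha> e = \<alpha> e' \<or> \<beta> e = \<beta> e'" for e e' \<rho> \<rho>'
  proof -
    obtain i k l i' k' l' where e: "e = (i, k, l)" "e' = (i', k', l')" by (cases e, cases e')
    then have r: "i mod s = \<rho>" "i' mod s = \<rho>'" using that by (auto simp: E_def)
    from that(3) have "\<exists>a b. int (a * s) - int i = int (b * s) - int i'"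
      by (auto simp: e \<alpha>_def \<beta>_def)
    then obtain a b where "int (a * s) - int i = int (b * s) - int i'" by blast
    then have "i' + a * s = i + b * s" by linarith
    then show ?thesis using r by (metis mod_mult_self1)
  qed
  define A where "A = (\<lambda>\<rho>. \<alpha> ` E \<rho> \<union> \<beta> ` E \<rho>)"
  have AI: "A \<rho> \<subseteq> I" for \<rho> using \<alpha>I \<beta>I by (simp add: A_def)
  have disj: "disjoint_family_on A {..<s}"
    unfolding disjoint_family_on_def
  proof (intro ballI impI)
    fix \<rho> \<rho>' :: nat assume "\<rho> \<noteq> \<rho>'"
    then have "x \<notin> A \<rho>'" if "x \<in> A \<rho>" for x
      using that cls \<alpha>\<beta> unfolding A_def by (auto, metis+)
    then show "A \<rho> \<inter> A \<rho>' = {}" by auto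
  qed
  have Rdet: "determined_by (A \<rho>) (R \<rho>)" for \<rho>
    unfolding R_def A_def by (intro determined_by_sum) (auto simp: determined_by_def)
  have PR: "sign_mean I (\<lambda>w. of_bool (R \<rho> w \<ge> \<theta>)) \<ge> 1 / 32" if \<rho>: "\<rho> < s" for \<rho>
  proof -
    obtain P where P: "P \<subseteq> {(e, e'). e \<in> E \<rho> \<and> e' \<in> E \<rho> \<and> \<alpha> e = \<alpha> e' \<and> \<beta> e = \<beta> e'}"
      "V \<le> real (card P)"
      using coincidence_count[OF s \<rho>, of c0 "c0 + 2 * m"] unfolding E_def \<alpha>_def \<beta>_def V_def by blast
    have "\<alpha> ` E \<rho> \<inter> \<beta> ` E \<rho> = {}" using \<alpha>\<beta> by auto
    then show ?thesis unfolding R_def \<theta>_def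
      by (rule bilinear_sum_anticoncentration[OF fI \<alpha>I \<beta>I _ finE order_refl order_refl P(1) V P(2)])
  qed
  define H where "H = (\<lambda>w. \<forall>\<rho><s. R \<rho> w \<ge> \<theta>)"
  have PH: "1 / 2 ^ (5 * s) \<le> sign_mean I (\<lambda>w. of_bool (H w))"
  proof -
    have Hp: "of_bool (H w) = (\<Prod>\<rho><s. of_bool (R \<rho> w \<ge> \<theta>) :: real)" for w
    proof (cases "H w")
      case False
      then obtain \<rho> where "\<rho> < s" "\<not> R \<rho> w \<ge> \<theta>" by (auto simp: H_def)
      then show ?thesis using False by (auto intro!: prod_zero[symmetric])
    qed (auto simp: H_def)
    have "(1 / 2 ^ (5 * s) :: real) = (\<Prod>\<rho><s. 1 / 32)"
      by (simp add: power_mult power_one_over)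
    also have "\<dots> \<le> (\<Prod>\<rho><s. sign_mean I (\<lambda>w. of_bool (R \<rho> w \<ge> \<theta>)))"
      using PR by (intro prod_mono) auto
    also have "\<dots> = sign_mean I (\<lambda>w. \<Prod>\<rho><s. of_bool (R \<rho> w \<ge> \<theta>))"
      by (rule sign_mean_prod_indep[OF fI _ AI disj, symmetric])
         (auto intro: determined_by_comp[OF Rdet, where h = "\<lambda>x. of_bool (x \<ge> \<theta>)"])
    finally show ?thesis by (simp only: Hp)
  qed
  \<comment> \<open>The contributions of the two combs to row \<open>i\<close> before the signs of
    \<open>D\<close> are applied.\<close>
  define u where "u = (\<lambda>w i. \<Sum>k<s. w (Inl (int (c0 + k * s) - int i) :: int + nat) :: real)"
  define v where "v = (\<lambda>w i. \<Sum>l<s. w (Inl (int (c0 + 2 * m + l * s) - int i) :: int + nat) :: real)"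
  have uv: "(\<Sum>i<m. u w i * v w i) = (\<Sum>\<rho><s. R \<rho> w)" for w
  proof -
    have "R \<rho> w = (\<Sum>i\<in>{i \<in> {..<m}. i mod s = \<rho>}. u w i * v w i)" for \<rho>
    proof -
      have "E \<rho> = {i \<in> {..<m}. i mod s = \<rho>} \<times> ({..<s} \<times> {..<s})" by (auto simp: E_def)
      then show ?thesis
        by (simp add: R_def u_def v_def sum_product sum.cartesian_product \<alpha>_def \<beta>_def case_prod_beta)
    qed
    moreover have "(\<Sum>\<rho><s. \<Sum>i\<in>{i \<in> {..<m}. i mod s = \<rho>}. u w i * v w i) = (\<Sum>i<m. u w i * v w i)"
      using s by (intro sum.group) auto
    ultimately show ?thesis by simp
  qed
  define base where "base = (\<lambda>w. (\<Sum>i<m. (u w i)\<^sup>2 + (v w i)\<^sup>2) - real m * (2 * real s))"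
  have dcomb: "comb c0 s \<inter> comb (c0 + 2 * m) s = {}"
    using comb_bounds[OF s(2)] m by fastforce
  have fcomb: "finite (comb c s)" for c by (simp add: comb_def)
  have cardJ: "card J = 2 * s"
    unfolding J_def using dcomb fcomb s by (simp add: card_Un_disjoint card_comb)
  have Jn: "j < n" if "j \<in> J" for j
    using that comb_bounds[OF s(2)] n s m unfolding J_def by fastforce
  define G where "G = (\<lambda>\<sigma> (w :: int + nat \<Rightarrow> real). \<forall>x\<in>Inr ` Suc ` J. w x = (if x \<in> Inr ` Suc ` comb c0 s then 1 else \<sigma> :: real))"
  have PG: "sign_mean I (\<lambda>w. of_bool (G \<sigma> w)) = 1 / 2 ^ (2 * s)" if "\<sigma> = 1 \<or> \<sigma> = -1" for \<sigma>
  proof -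
    have "sign_mean I (\<lambda>w. of_bool (G \<sigma> w)) = 1 / 2 ^ card (Inr ` Suc ` J :: (int + nat) set)"
      unfolding G_def using that Jn by (intro sign_mean_coords_fixed[OF fI]) (auto simp: Inr_I Suc_le_eq)
    then show ?thesis by (simp add: card_image cardJ)
  qed
  have norm: "(\<Sum>i<m. (row_sum J w i)\<^sup>2) - real m * real (card J) = base w + 2 * \<sigma> * (\<Sum>\<rho><s. R \<rho> w)"
    if "G \<sigma> w" "\<sigma> = 1 \<or> \<sigma> = -1" for \<sigma> w
  proof -
    have "row_sum J w i = u w i + \<sigma> * v w i" for i
    proof -
      have "row_sum J w i = row_sum (comb c0 s) w i + row_sum (comb (c0 + 2 * m) s) w i"
        unfolding row_sum_def J_def by (rule sum.union_disjoint[OF fcomb fcomb dcomb])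
      moreover have "row_sum (comb c0 s) w i = u w i"
      proof -
        have "row_sum (comb c0 s) w i = (\<Sum>j\<in>comb c0 s. w (Inl (int j - int i)))"
          unfolding row_sum_def using that(1) by (intro sum.cong) (auto simp: G_def J_def)
        then show ?thesis using s by (simp add: sum_comb u_def)
      qed
      moreover have "row_sum (comb (c0 + 2 * m) s) w i = \<sigma> * v w i"
      proof -
        have "row_sum (comb (c0 + 2 * m) s) w i = (\<Sum>j\<in>comb (c0 + 2 * m) s. \<sigma> * w (Inl (int j - int i)))"
          unfolding row_sum_def
        proof (rule sum.cong[OF refl])
          fix j assume j: "j \<in> comb (c0 + 2 * m) s"
          then have "j \<notin> comb c0 s" using dcomb by auto
          then have "(Inr (Suc j) :: int + nat) \<notin> Inr ` Suc ` comb c0 s" by auto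
          then have "w (Inr (Suc j)) = \<sigma>" using that(1) j by (auto simp: G_def J_def)
          then show "w (Inl (int j - int i)) * w (Inr (j + 1)) = \<sigma> * w (Inl (int j - int i))" by simp
        qed
        then show ?thesis using s by (simp add: sum_comb v_def sum_distrib_left)
      qed
      ultimately show ?thesis by simp
    qed
    then have "(\<Sum>i<m. (row_sum J w i)\<^sup>2) = (\<Sum>i<m. (u w i)\<^sup>2 + (v w i)\<^sup>2 + 2 * \<sigma> * (u w i * v w i))"
      using that(2) by (intro sum.cong) (auto simp: power2_eq_square algebra_simps)
    also have "\<dots> = (\<Sum>i<m. (u w i)\<^sup>2 + (v w i)\<^sup>2) + 2 * \<sigma> * (\<Sum>i<m. u w i * v w i)"
      by (simp add: sum.distrib sum_distrib_left)
    finally show ?thesis by (simp add: uv base_def cardJ)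
  qed
  \<comment> \<open>Since \<open>sqrt 32 \<le> 6\<close> and \<open>\<theta>\<close> is half of
    \<open>sqrt V\<close>, each class contributes at least \<open>s * sqrt m / 12\<close>; this is
    the origin of the 12 in the hypothesis.\<close>
  have big: "2 * (\<Sum>\<rho><s. R \<rho> w) > \<epsilon> * (real m * real (card J))" if "H w" for w
  proof -
    have "sqrt 32 \<le> 6" by (rule real_le_lsqrt) auto
    moreover have "sqrt V = s * sqrt m / sqrt 32" by (simp add: V_def real_sqrt_divide real_sqrt_mult)
    ultimately have "s * sqrt m / 6 \<le> sqrt V"
      by (simp only:) (intro divide_left_mono, auto)
    then have "s * sqrt m / 12 \<le> \<theta>" by (simp add: \<theta>_def)
    then have "real s * (s * sqrt m / 12) \<le> real s * \<theta>" by (intro mult_left_mono) auto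
    also have "\<dots> = (\<Sum>\<rho><s. \<theta>)" by simp
    also have "\<dots> \<le> (\<Sum>\<rho><s. R \<rho> w)" using that by (intro sum_mono) (auto simp: H_def)
    finally have 1: "real s * (s * sqrt m / 12) \<le> (\<Sum>\<rho><s. R \<rho> w)" .
    have "\<epsilon> * (real m * real (card J)) = 2 * (real s * (12 * \<epsilon> * sqrt m * sqrt m / 12))"
      by (simp add: cardJ)
    also have "\<dots> < 2 * (real s * (s * sqrt m / 12))"
      using \<epsilon> s m by (intro mult_strict_left_mono divide_strict_right_mono mult_strict_right_mono) auto
    finally show ?thesis using 1 by linarith
  qed
  have indep: "sign_mean I (\<lambda>w. of_bool (G \<sigma> w) * of_bool (H w \<and> Q (base w)))
      = sign_mean I (\<lambda>w. of_bool (G \<sigma> w)) * sign_mean I (\<lambda>w. of_bool (H w \<and> Q (base w)))" for \<sigma> Q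
  proof (rule sign_mean_mult_indep[OF fI, where A = "Inr ` Suc ` J" and B = "range Inl"])
    show "Inr ` Suc ` J \<subseteq> I" using Jn by (auto simp: Inr_I Suc_le_eq)
    show "determined_by (Inr ` Suc ` J) (\<lambda>w. of_bool (G \<sigma> w) :: real)"
      unfolding determined_by_def G_def by auto
    have HB: "H w = H w' \<and> base w = base w'" if "\<forall>i\<in>range Inl. w i = w' i" for w w'
    proof -
      have "u w = u w'" "v w = v w'" using that by (auto simp: u_def v_def)
      moreover have "R \<rho> w = R \<rho> w'" for \<rho>
        unfolding R_def by (rule sum.cong) (use that in \<open>auto simp: \<alpha>_def \<beta>_def\<close>)
      ultimately show ?thesis by (simp add: H_def base_def)
    qed
    show "determined_by (range Inl) (\<lambda>w. of_bool (H w \<and> Q (base w)) :: real)"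
      unfolding determined_by_def
    proof (intro allI impI)
      fix w w' :: "int + nat \<Rightarrow> real" assume "\<forall>i\<in>range Inl. w i = w' i"
      then show "of_bool (H w \<and> Q (base w)) = (of_bool (H w' \<and> Q (base w')) :: real)"
        using HB[of w w'] by simp
    qed
  qed auto
  \<comment> \<open>The event \<open>H\<close> costs \<open>5 * s\<close> in the exponent and the
    prescribed diagonal signs \<open>2 * s\<close>; \<open>8 * s\<close> leaves slack.\<close>
  have "(1 / 2 ^ (8 * s) :: real) \<le> 1 / 2 ^ (2 * s) * (1 / 2 ^ (5 * s))"
    by (simp add: power_add[symmetric] divide_simps)
  also have "\<dots> \<le> 1 / 2 ^ (2 * s) * sign_mean I (\<lambda>w. of_bool (H w))"
    using PH by (intro mult_left_mono) auto
  \<comment> \<open>Each part of \<open>H\<close> is paired with the value of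
    \<open>\<sigma>\<close> that agrees with the sign of \<open>base\<close>. Both diagonal patterns
    have the same probability, so the split loses nothing.\<close>
  also have "sign_mean I (\<lambda>w. of_bool (H w))
      = sign_mean I (\<lambda>w. of_bool (H w \<and> base w \<ge> 0)) + sign_mean I (\<lambda>w. of_bool (H w \<and> base w < 0))"
    unfolding sign_mean_add[symmetric] by (rule sign_mean_cong) auto
  also have "1 / 2 ^ (2 * s) * \<dots> = sign_mean I (\<lambda>w. of_bool (G 1 w) * of_bool (H w \<and> base w \<ge> 0)
      + of_bool (G (-1) w) * of_bool (H w \<and> base w < 0))"
    using indep[of 1 "\<lambda>x. x \<ge> 0"] indep[of "-1" "\<lambda>x. x < 0"] PG[of 1] PG[of "-1"]
    by (simp add: sign_mean_add distrib_left)
  also have "\<dots> \<le> sign_mean I (\<lambda>w. of_bool (distorted m \<epsilon> J w))"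
  proof (rule sign_mean_mono)
    fix w
    have "distorted m \<epsilon> J w" if "G 1 w" "H w" "base w \<ge> 0"
      using norm[OF that(1)] big[OF that(2)] that(3) unfolding distorted_def by simp
    moreover have "distorted m \<epsilon> J w" if "G (-1) w" "H w" "base w < 0"
      using norm[OF that(1)] big[OF that(2)] that(3) unfolding distorted_def by simp
    ultimately show "of_bool (G 1 w) * of_bool (H w \<and> base w \<ge> 0)
      + of_bool (G (-1) w) * of_bool (H w \<and> base w < 0) \<le> (of_bool (distorted m \<epsilon> J w) :: real)"
      by (cases "base w \<ge> 0") auto
  qed
  finally show ?thesis unfolding I_def .
qed

section \<open>Families of indicator vectors\<close>

definition indicator_vec :: "nat \<Rightarrow> nat set \<Rightarrow> real vec" where
  "indicator_vec n J = vec n (\<lambda>j. of_bool (j \<in> J))"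

text \<open>Spelled exactly like the event in the theorem, so that it can be folded there.\<close>

definition preserving :: "nat \<Rightarrow> nat \<Rightarrow> real \<Rightarrow> real vec set \<Rightarrow> (int + nat \<Rightarrow> real) set" where
  "preserving m n \<epsilon> X =
    {w. let T = toeplitz_mat m n (\<lambda>k. w (Inl k)); D = diagonal_mat_of n (\<lambda>i. w (Inr i)) in
            \<forall>x\<in>X. \<forall>y\<in>X.
              \<bar>(l2_norm ((1 / sqrt m) \<cdot>\<^sub>v ((T * D) *\<^sub>v x) - (1 / sqrt m) \<cdot>\<^sub>v ((T * D) *\<^sub>v y)))\<^sup>2
                - (l2_norm (x - y))\<^sup>2\<bar>
              \<le> \<epsilon> * (l2_norm (x - y))\<^sup>2}"

lemma l2_norm_square: "(l2_norm v)\<^sup>2 = (\<Sum>i<dim_vec v. (v $ i)\<^sup>2)"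
  by (simp add: l2_norm_def L2_set_def sum_nonneg)

lemma toeplitz_diagonal_mult:
  assumes "x \<in> carrier_vec n" "i < m"
  shows "((toeplitz_mat m n t * diagonal_mat_of n d) *\<^sub>v x) $ i = (\<Sum>j<n. t (int j - int i) * d (j + 1) * x $ j)"
proof -
  have "toeplitz_mat m n t * diagonal_mat_of n d
      = mat m n (\<lambda>(i, j). toeplitz_mat m n t $$ (i, j) * d (j + 1))"
    unfolding diagonal_mat_of_def by (rule mat_diag_mult_right) (simp add: toeplitz_mat_def)
  then show ?thesis
    using assms by (auto simp: scalar_prod_def toeplitz_mat_def lessThan_atLeast0 intro!: sum.cong)
qed

text \<open>Compares the indicator vector with the origin, whose image is 0; the squared norm of the
  indicator vector is \<open>card J\<close>.\<close>

lemma preserving_imp_not_distorted: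
  assumes m: "m \<ge> 1" and J: "J \<subseteq> {..<n}"
    and w: "w \<in> preserving m n \<epsilon> X" and X: "0\<^sub>v n \<in> X" "indicator_vec n J \<in> X"
  shows "\<not> distorted m \<epsilon> J w"
proof -
  define T where "T = toeplitz_mat m n (\<lambda>k. w (Inl k))"
  define D where "D = diagonal_mat_of n (\<lambda>i. w (Inr i))"
  let ?x = "indicator_vec n J"
  let ?d = "(1 / sqrt m) \<cdot>\<^sub>v ((T * D) *\<^sub>v ?x) - (1 / sqrt m) \<cdot>\<^sub>v ((T * D) *\<^sub>v 0\<^sub>v n)"
  have dim: "dim_row (T * D) = m" by (simp add: T_def toeplitz_mat_def)
  have x: "?x \<in> carrier_vec n" by (simp add: indicator_vec_def)
  have "?d $ i = row_sum J w i / sqrt m" if "i < m" for i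
  proof -
    have "((T * D) *\<^sub>v ?x) $ i = (\<Sum>j<n. w (Inl (int j - int i)) * w (Inr (j + 1)) * ?x $ j)"
      unfolding T_def D_def by (rule toeplitz_diagonal_mult[OF x that])
    also have "\<dots> = (\<Sum>j<n. if j \<in> J then w (Inl (int j - int i)) * w (Inr (j + 1)) else 0)"
      by (intro sum.cong) (auto simp: indicator_vec_def)
    also have "\<dots> = row_sum J w i"
      unfolding row_sum_def using J by (simp add: sum.If_cases Int_absorb1)
    finally have 1: "((T * D) *\<^sub>v ?x) $ i = row_sum J w i" .
    have "((T * D) *\<^sub>v 0\<^sub>v n) $ i = (\<Sum>j<n. w (Inl (int j - int i)) * w (Inr (j + 1)) * 0\<^sub>v n $ j)"
      unfolding T_def D_def by (rule toeplitz_diagonal_mult) (use that in auto)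
    then have 2: "((T * D) *\<^sub>v 0\<^sub>v n) $ i = 0" by simp
    have "?d $ i = 1 / sqrt m * ((T * D) *\<^sub>v ?x) $ i - 1 / sqrt m * ((T * D) *\<^sub>v 0\<^sub>v n) $ i"
      using that dim by (simp del: index_mult_mat_vec)
    then show ?thesis by (simp only: 1 2) simp
  qed
  then have "(l2_norm ?d)\<^sup>2 = (\<Sum>i<m. (row_sum J w i / sqrt m)\<^sup>2)"
    unfolding l2_norm_square using dim by simp
  also have "\<dots> = (\<Sum>i<m. (row_sum J w i)\<^sup>2) / m"
    by (simp add: power_divide sum_divide_distrib)
  finally have a: "(l2_norm ?d)\<^sup>2 = (\<Sum>i<m. (row_sum J w i)\<^sup>2) / m" .
  have "(l2_norm (?x - 0\<^sub>v n))\<^sup>2 = (\<Sum>j<n. of_bool (j \<in> J))"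
    unfolding l2_norm_square by (intro sum.cong) (auto simp: indicator_vec_def)
  also have "\<dots> = real (card J)" using J by (simp add: inf.absorb2 inf.absorb1)
  finally have b: "(l2_norm (?x - 0\<^sub>v n))\<^sup>2 = real (card J)" .
  have "\<bar>(l2_norm ?d)\<^sup>2 - (l2_norm (?x - 0\<^sub>v n))\<^sup>2\<bar> \<le> \<epsilon> * (l2_norm (?x - 0\<^sub>v n))\<^sup>2"
    using w X unfolding preserving_def mem_Collect_eq Let_def T_def D_def by blast
  then have "\<bar>(\<Sum>i<m. (row_sum J w i)\<^sup>2) / m - card J\<bar> \<le> \<epsilon> * card J" unfolding a b .
  then have "real m * \<bar>(\<Sum>i<m. (row_sum J w i)\<^sup>2) / m - card J\<bar> \<le> real m * (\<epsilon> * card J)"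
    by (rule mult_left_mono) simp
  moreover have "real m * \<bar>(\<Sum>i<m. (row_sum J w i)\<^sup>2) / m - card J\<bar>
      = \<bar>real m * ((\<Sum>i<m. (row_sum J w i)\<^sup>2) / m - card J)\<bar>" by (simp add: abs_mult)
  moreover have "real m * ((\<Sum>i<m. (row_sum J w i)\<^sup>2) / m - card J)
      = (\<Sum>i<m. (row_sum J w i)\<^sup>2) - real m * card J" using m by (simp add: right_diff_distrib)
  ultimately show ?thesis unfolding distorted_def by (simp add: mult_ac)
qed

lemma infinite_carrier_vec: "n \<ge> 1 \<Longrightarrow> infinite (carrier_vec n :: real vec set)"
proof
  assume n: "n \<ge> 1" and fin: "finite (carrier_vec n :: real vec set)"
  have "inj (\<lambda>r :: real. vec n (\<lambda>_. r))"
  proof (rule injI)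
    fix r r' :: real assume "vec n (\<lambda>_. r) = vec n (\<lambda>_. r')"
    then have "vec n (\<lambda>_. r) $ 0 = vec n (\<lambda>_. r') $ 0" by simp
    then show "r = r'" using n by simp
  qed
  moreover have "finite (range (\<lambda>r :: real. vec n (\<lambda>_. r)))"
    by (rule finite_subset[OF _ fin]) auto
  ultimately show False using finite_imageD infinite_UNIV_char_0 by blast
qed

text \<open>The hypothesis concerns sets of exactly \<open>N\<close> vectors. The origin and the
  indicator vectors are at most \<open>N\<close>, and padding with arbitrary further vectors only
  shrinks the preserved event.\<close>

lemma undistorted_family_prob:
  assumes m: "m \<ge> 1" and n: "n \<ge> 1"
    and hyp: "\<And>X. X \<subseteq> carrier_vec n \<Longrightarrow> card X = N \<Longrightarrow>
        p \<le> measure_pmf.prob (entries_pmf m n) (preserving m n \<epsilon> X)"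
    and F: "finite F" "card F < N" "\<And>J. J \<in> F \<Longrightarrow> J \<subseteq> {..<n}"
  shows "p \<le> sign_mean (entry_indices m n) (\<lambda>w. of_bool (\<forall>J\<in>F. \<not> distorted m \<epsilon> J w))"
proof -
  define X0 where "X0 = insert (0\<^sub>v n) (indicator_vec n ` F)"
  have X0: "finite X0" "X0 \<subseteq> carrier_vec n" using F by (auto simp: X0_def indicator_vec_def)
  have "card X0 \<le> Suc (card (indicator_vec n ` F))" unfolding X0_def by (rule card_insert_le_m1) simp_all
  also have "\<dots> \<le> N" using card_image_le[OF F(1), of "indicator_vec n"] F(2) by simp
  finally have cX0: "card X0 \<le> N" .
  have "infinite (carrier_vec n - X0)" using infinite_carrier_vec[OF n] X0 by simp
  then obtain Y where Y: "finite Y" "card Y = N - card X0" "Y \<subseteq> carrier_vec n - X0"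
    using infinite_arbitrarily_large by metis
  have "card (X0 \<union> Y) = N" using Y X0 cX0 by (subst card_Un_disjoint) auto
  then have "p \<le> measure_pmf.prob (entries_pmf m n) (preserving m n \<epsilon> (X0 \<union> Y))"
    using X0 Y by (intro hyp) auto
  also have "\<dots> = sign_mean (entry_indices m n) (\<lambda>w. of_bool (w \<in> preserving m n \<epsilon> (X0 \<union> Y)))"
    by (rule measure_entries_pmf)
  also have "\<dots> \<le> sign_mean (entry_indices m n) (\<lambda>w. of_bool (\<forall>J\<in>F. \<not> distorted m \<epsilon> J w))"
  proof (rule sign_mean_mono)
    fix w
    have "\<forall>J\<in>F. \<not> distorted m \<epsilon> J w" if "w \<in> preserving m n \<epsilon> (X0 \<union> Y)"
      using preserving_imp_not_distorted[OF m F(3) that] by (auto simp: X0_def)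
    then show "of_bool (w \<in> preserving m n \<epsilon> (X0 \<union> Y)) \<le> (of_bool (\<forall>J\<in>F. \<not> distorted m \<epsilon> J w) :: real)"
      by auto
  qed
  finally show ?thesis .
qed

section \<open>Independence across blocks of columns\<close>

text \<open>The \<open>m\<close> rows extend the \<open>3 * m\<close> columns of a block by
  \<open>m - 1\<close> Toeplitz indices to the left, so blocks starting \<open>4 * m\<close> apart
  share no entries.\<close>

definition block_indices :: "nat \<Rightarrow> nat \<Rightarrow> (int + nat) set" where
  "block_indices m c = {int c - int m<..<int c + 3 * int m} <+> {c<..c + 3 * m}"

lemma distorted_determined_by:
  assumes "J \<subseteq> {c..<c + 3 * m}"
  shows "determined_by (block_indices m c) (distorted m \<epsilon> J)"
proof -
  have row: "row_sum J w i = row_sum J w' i" if "\<forall>x\<in>block_indices m c. w x = w' x" "i < m" for w w' i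
    unfolding row_sum_def
  proof (rule sum.cong[OF refl])
    fix j assume "j \<in> J"
    then have "Inl (int j - int i) \<in> block_indices m c" "Inr (j + 1) \<in> block_indices m c"
      using assms that(2) by (auto simp: block_indices_def)
    then show "w (Inl (int j - int i)) * w (Inr (j + 1)) = w' (Inl (int j - int i)) * w' (Inr (j + 1))"
      using that(1) by simp
  qed
  have "(\<Sum>i<m. (row_sum J w i)\<^sup>2) = (\<Sum>i<m. (row_sum J w' i)\<^sup>2)"
    if "\<forall>x\<in>block_indices m c. w x = w' x" for w w'
    using row[OF that] by simp
  then have "distorted m \<epsilon> J w = distorted m \<epsilon> J w'" if "\<forall>x\<in>block_indices m c. w x = w' x" for w w'
    using that unfolding distorted_def by metis
  then show ?thesis unfolding determined_by_def by blast
qed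

lemma disjoint_blocks: "disjoint_family_on (\<lambda>g. block_indices m (4 * m * g)) K"
proof -
  have "block_indices m (4 * m * g) \<inter> block_indices m (4 * m * h) = {}" if "g < h" for g h
  proof -
    have "4 * m * Suc g \<le> 4 * m * h" using that by (intro mult_le_mono2) auto
    then have gh: "4 * m * g + 4 * m \<le> 4 * m * h" by simp
    then have "int (4 * m * g + 4 * m) \<le> int (4 * m * h)" by (rule of_nat_mono)
    then have "int (4 * m * g) + 4 * int m \<le> int (4 * m * h)" by simp
    then show ?thesis using gh unfolding block_indices_def by (auto simp del: of_nat_mult)
  qed
  then show ?thesis unfolding disjoint_family_on_def by (metis Int_commute linorder_neqE_nat)
qed

lemma success_prob_le:
  assumes m: "m \<ge> 1" and n: "n \<ge> 1" and \<epsilon>: "0 < \<epsilon>" "12 * \<epsilon> * sqrt m < s"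
    and s: "s \<ge> 1" "s * s \<le> m" and N: "N \<ge> 1" "4 * m * N \<le> n"
    and hyp: "\<And>X. X \<subseteq> carrier_vec n \<Longrightarrow> card X = N \<Longrightarrow>
        p \<le> measure_pmf.prob (entries_pmf m n) (preserving m n \<epsilon> X)"
  shows "p \<le> (1 - 1 / 2 ^ (8 * s)) ^ (N - 1)"
proof -
  define I where "I = entry_indices m n"
  have fI: "finite I" by (simp add: I_def finite_entry_indices)
  define J where "J = (\<lambda>g. comb (4 * m * g) s \<union> comb (4 * m * g + 2 * m) s)"
  \<comment> \<open>Each comb lies within \<open>m\<close> columns and the second starts
    \<open>2 * m\<close> after the first.\<close>
  have Jb: "J g \<subseteq> {4 * m * g..<4 * m * g + 3 * m}" for g
    unfolding J_def using comb_bounds[OF s(2)] s(1) by fastforce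
  have gn: "4 * m * g + 3 * m \<le> n" if "g < N - 1" for g
  proof -
    have "4 * m * Suc g \<le> 4 * m * N" using that by (intro mult_le_mono2) auto
    then show ?thesis using N by simp
  qed
  have "p \<le> sign_mean I (\<lambda>w. of_bool (\<forall>K\<in>J ` {..<N - 1}. \<not> distorted m \<epsilon> K w))"
    unfolding I_def
  proof (rule undistorted_family_prob[OF m n hyp])
    have "card (J ` {..<N - 1}) \<le> card {..<N - 1}" by (rule card_image_le) simp
    then show "card (J ` {..<N - 1}) < N" using N(1) by simp
    fix K assume "K \<in> J ` {..<N - 1}"
    then obtain g where "g < N - 1" "K = J g" by auto
    then show "K \<subseteq> {..<n}" using Jb[of g] gn[of g] by fastforce
  qed auto
  also have "\<dots> = sign_mean I (\<lambda>w. \<Prod>g<N - 1. 1 - of_bool (distorted m \<epsilon> (J g) w))"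
  proof (rule sign_mean_cong)
    fix w :: "int + nat \<Rightarrow> real"
    show "of_bool (\<forall>K\<in>J ` {..<N - 1}. \<not> distorted m \<epsilon> K w) = (\<Prod>g<N - 1. 1 - of_bool (distorted m \<epsilon> (J g) w) :: real)"
    proof (cases "\<exists>g<N - 1. distorted m \<epsilon> (J g) w")
      case True
      then show ?thesis by (auto intro!: prod_zero[symmetric])
    next
      case False
      then show ?thesis by simp
    qed
  qed
  also have "\<dots> = (\<Prod>g<N - 1. sign_mean I (\<lambda>w. 1 - of_bool (distorted m \<epsilon> (J g) w)))"
  proof (rule sign_mean_prod_indep[OF fI _ _ disjoint_blocks[of m]])
    show "block_indices m (4 * m * g) \<subseteq> I" if "g \<in> {..<N - 1}" for g
      using gn[of g] that by (auto simp: block_indices_def I_def entry_indices_def simp flip: of_nat_mult)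
    show "determined_by (block_indices m (4 * m * g)) (\<lambda>w. 1 - of_bool (distorted m \<epsilon> (J g) w) :: real)" for g
      by (rule determined_by_comp[OF distorted_determined_by[OF Jb], where h = "\<lambda>b. 1 - of_bool b"])
  qed simp
  also have "\<dots> \<le> (\<Prod>g<N - 1. 1 - 1 / 2 ^ (8 * s))"
  proof (rule prod_mono)
    fix g assume g: "g \<in> {..<N - 1}"
    have "1 / 2 ^ (8 * s) \<le> sign_mean I (\<lambda>w. of_bool (distorted m \<epsilon> (J g) w))"
      unfolding I_def J_def using g gn by (intro distortion_prob[OF s _ \<epsilon>]) auto
    moreover have "0 \<le> sign_mean I (\<lambda>w. 1 - of_bool (distorted m \<epsilon> (J g) w))"
      by (rule sign_mean_nonneg) auto
    ultimately show "0 \<le> sign_mean I (\<lambda>w. 1 - of_bool (distorted m \<epsilon> (J g) w)) \<and>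
        sign_mean I (\<lambda>w. 1 - of_bool (distorted m \<epsilon> (J g) w)) \<le> 1 - 1 / 2 ^ (8 * s)"
      by (simp add: sign_mean_diff sign_mean_const[OF fI])
  qed
  finally show ?thesis by simp
qed

text \<open>By \<open>1 - q \<le> exp (- q)\<close>, the hypothesis forces
  \<open>(N - 1) * q \<le> ln (1 / p)\<close> for \<open>q = 1 / 2 ^ k\<close>. The maximum with 1
  keeps the logarithm of this bound nonnegative.\<close>

lemma log_size_le:
  fixes p :: real
  assumes p: "p > 0" "p \<le> (1 - 1 / 2 ^ k) ^ (N - 1)" and N: "N \<ge> 2"
  shows "log 2 N \<le> 1 + log 2 (max 1 (ln (1 / p))) + k"
proof -
  define \<Lambda> where "\<Lambda> = max 1 (ln (1 / p))"
  define q :: real where "q = 1 / 2 ^ k"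
  have q: "0 < q" "q \<le> 1" by (auto simp: q_def)
  have "p \<le> (1 - q) ^ (N - 1)" using p(2) by (simp add: q_def)
  also have "\<dots> \<le> exp (- q) ^ (N - 1)" using exp_ge_add_one_self[of "- q"] q by (intro power_mono) auto
  also have "\<dots> = exp (- (real (N - 1) * q))" by (simp add: exp_of_nat_mult[symmetric])
  finally have "ln p \<le> - (real (N - 1) * q)" using p(1) by (metis exp_gt_zero ln_exp ln_le_cancel_iff)
  then have "real (N - 1) * q \<le> \<Lambda>" using p(1) by (simp add: \<Lambda>_def ln_div)
  moreover have "real N \<le> 2 * real (N - 1)" using N by (auto simp: of_nat_diff)
  moreover have "real N * q \<le> 2 * real (N - 1) * q" using calculation(2) q by (intro mult_right_mono) auto
  ultimately have "real N * q \<le> 2 * \<Lambda>" by linarith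
  then have le: "real N \<le> 2 * \<Lambda> * 2 ^ k" by (simp add: q_def divide_le_eq)
  have \<Lambda>: "\<Lambda> \<ge> 1" by (simp add: \<Lambda>_def)
  have "log 2 N \<le> log 2 (2 * \<Lambda> * 2 ^ k)" using le N by (intro log_mono) auto
  also have "\<dots> = 1 + log 2 \<Lambda> + k" using \<Lambda> by (simp add: log_mult log_nat_power)
  finally show ?thesis by (simp add: \<Lambda>_def)
qed

section \<open>Anticoncentration for a single vector\<close>

text \<open>The square of row \<open>i\<close> is 2 plus twice a product of two Toeplitz and two
  diagonal signs. Column \<open>m\<close> uses Toeplitz indices from 1 to \<open>m\<close>, column 0
  only indices up to 0. Given column 0 and the diagonal, the products are therefore \<open>m\<close>
  independent signs.\<close>

lemma success_prob_le_two_columns: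
  assumes m: "m \<ge> 1" and \<epsilon>: "\<epsilon> > 0" and n: "2 * m \<le> n"
  shows "sign_mean (entry_indices m n) (\<lambda>w. of_bool (\<not> distorted m \<epsilon> {0, m} w)) \<le> (2 * (\<epsilon> * m) + 1) / sqrt m"
proof -
  define I where "I = entry_indices m n"
  have fI: "finite I" by (simp add: I_def finite_entry_indices)
  \<comment> \<open>\<open>l = Inl k\<close> belongs to row \<open>m - k\<close>, whose entry in
    column 0 has index \<open>k - m\<close>.\<close>
  define e where "e = (\<lambda>(l :: int + nat) (w :: int + nat \<Rightarrow> real). w (Inl (projl l - int m)) * w (Inr 1) * w (Inr (m + 1)))"
  define B where "B = (Inl ` {1..int m} :: (int + nat) set)"
  define A where "A = (Inl ` {..0} \<union> range Inr :: (int + nat) set)"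
  have BI: "B \<subseteq> I" using n by (auto simp: B_def I_def entry_indices_def)
  have "sign_mean I (\<lambda>w. of_bool (\<not> distorted m \<epsilon> {0, m} w))
      \<le> sign_mean I (\<lambda>w. of_bool (\<bar>(\<Sum>l\<in>B. w l * e l w) - 0\<bar> \<le> \<epsilon> * m))"
  proof (rule sign_mean_mono)
    fix w :: "int + nat \<Rightarrow> real" assume w: "w \<in> signs I"
    let ?a = "\<lambda>i. w (Inl (- int i))" and ?b = "\<lambda>i. w (Inl (int m - int i))"
    have sum: "(\<Sum>l\<in>B. w l * e l w) = (\<Sum>i<m. ?b i * (?a i * w (Inr 1) * w (Inr (m + 1))))"
      unfolding B_def
      by (subst sum.reindex) (auto simp: e_def intro!: sum.reindex_bij_witness[of _ "\<lambda>i. int m - int i" "\<lambda>k. nat (int m - k)"])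
    have "(row_sum {0, m} w i)\<^sup>2 = 2 + 2 * (?b i * (?a i * w (Inr 1) * w (Inr (m + 1))))" if "i < m" for i
    proof -
      have "row_sum {0, m} w i = ?a i * w (Inr 1) + ?b i * w (Inr (m + 1))"
        using m by (simp add: row_sum_def)
      moreover have "(?a i)\<^sup>2 = 1" "(?b i)\<^sup>2 = 1" "(w (Inr 1))\<^sup>2 = 1" "(w (Inr (m + 1)))\<^sup>2 = 1"
        by (rule signs_square[OF w]; use that m n in \<open>auto simp: I_def entry_indices_def\<close>)+
      ultimately show ?thesis
        by (simp add: power2_sum power_mult_distrib)
    qed
    then have "(\<Sum>i<m. (row_sum {0, m} w i)\<^sup>2) = 2 * m + 2 * (\<Sum>l\<in>B. w l * e l w)"
      unfolding sum by (simp add: sum.distrib sum_distrib_left)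
    then have "\<bar>2 * (\<Sum>l\<in>B. w l * e l w)\<bar> \<le> 2 * (\<epsilon> * m)" if "\<not> distorted m \<epsilon> {0, m} w"
      using that m by (simp add: distorted_def)
    then show "of_bool (\<not> distorted m \<epsilon> {0, m} w) \<le> (of_bool (\<bar>(\<Sum>l\<in>B. w l * e l w) - 0\<bar> \<le> \<epsilon> * m) :: real)"
      by auto
  qed
  also have "\<dots> \<le> (2 * (\<epsilon> * m) + 1) / sqrt (card B)"
  proof (rule sign_sum_anticoncentration[OF fI BI, where A = A])
    show "A \<inter> B = {}" by (auto simp: A_def B_def)
    show "determined_by A (e l)" if "l \<in> B" for l
      using that by (auto simp: determined_by_def e_def A_def B_def)
    fix l and w :: "int + nat \<Rightarrow> real" assume l: "l \<in> B" and w: "w \<in> signs I"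
    have "w (Inl (projl l - int m)) = 1 \<or> w (Inl (projl l - int m)) = -1"
      "w (Inr 1) = 1 \<or> w (Inr 1) = -1" "w (Inr (m + 1)) = 1 \<or> w (Inr (m + 1)) = -1"
      by (rule signs_cases[OF w]; use l m n in \<open>auto simp: B_def I_def entry_indices_def\<close>)+
    then show "e l w = 1 \<or> e l w = -1" unfolding e_def by auto
  qed (use m \<epsilon> in \<open>auto simp: B_def\<close>)
  also have "card B = m" by (simp add: B_def card_image)
  finally show ?thesis unfolding I_def .
qed

text \<open>The distance between two squares is the product of the distances of \<open>y\<close> to
  both roots, and replacing a negative \<open>r\<close> by 0 only moves it closer to
  \<open>y^2\<close>.\<close>

lemma square_near_cases:
  fixes y r h :: real
  assumes "\<bar>y\<^sup>2 - r\<bar> \<le> h"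
  shows "\<bar>y - sqrt (max r 0)\<bar> \<le> sqrt h \<or> \<bar>y - (- sqrt (max r 0))\<bar> \<le> sqrt h"
proof (rule ccontr)
  define b where "b = sqrt (max r 0)"
  have h: "h \<ge> 0" using assms by linarith
  assume "\<not> ?thesis"
  then have "sqrt h < \<bar>y - b\<bar>" "sqrt h < \<bar>y + b\<bar>" by (auto simp: b_def)
  then have "sqrt h * sqrt h < \<bar>y - b\<bar> * \<bar>y + b\<bar>" using h by (intro mult_strict_mono) auto
  then have "h < \<bar>y\<^sup>2 - b\<^sup>2\<bar>" using h by (simp add: abs_mult[symmetric] power2_eq_square algebra_simps)
  moreover have "b\<^sup>2 = max r 0" by (simp add: b_def)
  ultimately show False using assms zero_le_power2[of y] by (auto simp: max_def abs_if split: if_splits)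
qed

text \<open>
  The columns \<open>k * m\<close> make the rows use disjoint Toeplitz entries. Given all the other rows, the
  square of row 0 would have to lie in a short interval.
\<close>

lemma success_prob_le_many_columns:
  assumes m: "m \<ge> 1" and s: "s \<ge> 1" and \<epsilon>: "\<epsilon> > 0" and n: "s * m \<le> n"
  defines "J \<equiv> (\<lambda>k. k * m) ` {..<s}"
  shows "sign_mean (entry_indices m n) (\<lambda>w. of_bool (\<not> distorted m \<epsilon> J w)) \<le> 4 * sqrt (\<epsilon> * m) + 2 / sqrt s"
proof -
  define I where "I = entry_indices m n"
  have fI: "finite I" by (simp add: I_def finite_entry_indices)
  define e where "e = (\<lambda>(l :: int + nat) (w :: int + nat \<Rightarrow> real). w (Inr (nat (projl l) + 1)))"
  define B where "B = ((\<lambda>k. Inl (int (k * m))) ` {..<s} :: (int + nat) set)"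
  \<comment> \<open>In row 0 the columns of \<open>J\<close> meet only indices divisible by
    \<open>m\<close>, in every other row none of these. So the remaining rows depend on
    \<open>A\<close> alone.\<close>
  define A where "A = (Inl ` {k. \<not> int m dvd k} \<union> range Inr :: (int + nat) set)"
  define r where "r = (\<lambda>w. real m * s - (\<Sum>i\<in>{1..<m}. (row_sum J w i)\<^sup>2))"
  \<comment> \<open>An error \<open>h^2\<close> in the square of row 0 becomes an error
    \<open>h\<close> in the row itself.\<close>
  define h where "h = sqrt (\<epsilon> * (real m * s))"
  define b where "b = (\<lambda>w. sqrt (max (r w) 0))"
  define S where "S = (\<lambda>w. \<Sum>l\<in>B. w l * e l w)"
  have inj: "inj_on (\<lambda>k. k * m) {..<s}" using m by (auto simp: inj_on_def)
  have cJ: "card J = s" unfolding J_def by (simp add: card_image[OF inj])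
  have cB: "card B = s" unfolding B_def using m by (subst card_image) (auto simp: inj_on_def)
  have km: "k * m < n" if "k < s" for k
  proof -
    have "k * m < Suc k * m" using m by simp
    also have "\<dots> \<le> s * m" using that by (intro mult_le_mono1) auto
    also have "\<dots> \<le> n" by (rule n)
    finally show ?thesis .
  qed
  have BI: "B \<subseteq> I" using km m by (auto simp: B_def I_def entry_indices_def simp flip: of_nat_mult)
  have S: "row_sum J w 0 = S w" for w
    unfolding row_sum_def S_def B_def J_def using m
    by (subst sum.reindex[OF inj], subst sum.reindex) (auto simp: inj_on_def e_def nat_mult_distrib)
  have rdet: "determined_by A r"
  proof -
    have row: "row_sum J w i = row_sum J w' i" if "\<forall>x\<in>A. w x = w' x" "i \<in> {1..<m}" for w w' i
      unfolding row_sum_def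
    proof (rule sum.cong[OF refl])
      fix j assume "j \<in> J"
      then obtain k where "j = k * m" by (auto simp: J_def)
      then have "int m dvd int j" by simp
      moreover have "\<not> int m dvd int i" using that(2) by (auto dest: dvd_imp_le)
      ultimately have "\<not> int m dvd int j - int i" by (metis dvd_diff_commute dvd_add_right_iff diff_add_cancel)
      then show "w (Inl (int j - int i)) * w (Inr (j + 1)) = w' (Inl (int j - int i)) * w' (Inr (j + 1))"
        using that(1) by (simp add: A_def)
    qed
    have "(\<Sum>i\<in>{1..<m}. (row_sum J w i)\<^sup>2) = (\<Sum>i\<in>{1..<m}. (row_sum J w' i)\<^sup>2)"
      if "\<forall>x\<in>A. w x = w' x" for w w' using row[OF that] by simp
    then show ?thesis unfolding determined_by_def r_def by metis
  qed
  have bound: "sign_mean I (\<lambda>w. of_bool (\<bar>S w - c w\<bar> \<le> h)) \<le> (2 * h + 1) / sqrt s" if c: "determined_by A c" for c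
    unfolding S_def cB[symmetric]
  proof (rule sign_sum_anticoncentration[OF fI BI, where A = A])
    show "A \<inter> B = {}" by (auto simp: A_def B_def)
    show "determined_by A (e l)" for l by (auto simp: determined_by_def e_def A_def)
    fix l and w :: "int + nat \<Rightarrow> real" assume l: "l \<in> B" and w: "w \<in> signs I"
    obtain k where k: "k < s" "l = Inl (int (k * m))" using l by (auto simp: B_def)
    have "(Inr (k * m + 1) :: int + nat) \<in> I" using km[OF k(1)] by (auto simp: I_def entry_indices_def)
    then show "e l w = 1 \<or> e l w = -1" using signs_cases[OF w] k(2) unfolding e_def by (simp del: of_nat_mult)
  qed (use c s \<epsilon> in \<open>auto simp: B_def h_def lessThan_empty_iff\<close>)
  have "sign_mean I (\<lambda>w. of_bool (\<not> distorted m \<epsilon> J w))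
      \<le> sign_mean I (\<lambda>w. of_bool (\<bar>S w - b w\<bar> \<le> h) + of_bool (\<bar>S w - (- b w)\<bar> \<le> h))"
  proof (rule sign_mean_mono)
    fix w
    have "\<bar>(S w)\<^sup>2 - r w\<bar> \<le> \<epsilon> * (real m * s)" if "\<not> distorted m \<epsilon> J w"
    proof -
      have "{..<m} = insert 0 {1..<m}" using m by auto
      then have "(\<Sum>i<m. (row_sum J w i)\<^sup>2) = (S w)\<^sup>2 + (\<Sum>i\<in>{1..<m}. (row_sum J w i)\<^sup>2)" by (simp add: S)
      then have "(S w)\<^sup>2 - r w = (\<Sum>i<m. (row_sum J w i)\<^sup>2) - real m * card J" by (simp add: r_def cJ)
      then show ?thesis using that by (simp add: distorted_def cJ)
    qed
    then have "\<bar>S w - b w\<bar> \<le> h \<or> \<bar>S w - (- b w)\<bar> \<le> h" if "\<not> distorted m \<epsilon> J w"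
      using that square_near_cases unfolding b_def h_def by blast
    then show "of_bool (\<not> distorted m \<epsilon> J w)
      \<le> (of_bool (\<bar>S w - b w\<bar> \<le> h) + of_bool (\<bar>S w - (- b w)\<bar> \<le> h) :: real)" by auto
  qed
  also have "\<dots> \<le> (2 * h + 1) / sqrt s + (2 * h + 1) / sqrt s"
    unfolding sign_mean_add b_def
    by (intro add_mono bound determined_by_comp[OF rdet, where h = "\<lambda>x. sqrt (max x 0)"]
        determined_by_comp[OF rdet, where h = "\<lambda>x. - sqrt (max x 0)"])
  \<comment> \<open>\<open>h / sqrt s\<close> does not depend on \<open>s\<close>, so a large
    \<open>s\<close> makes the rest small at no cost.\<close>
  also have "\<dots> = 4 * sqrt (\<epsilon> * m) + 2 / sqrt s"
    using s by (simp add: h_def real_sqrt_mult field_simps)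
  finally show ?thesis unfolding I_def .
qed

section \<open>Large and bounded \<open>N\<close> combined\<close>

text \<open>Takes the least integer \<open>s\<close> above \<open>12 * \<epsilon> * sqrt m\<close>.
  Then \<open>8 * s \<le> 96 * \<epsilon> * sqrt m + 8\<close>, which gives the constants 96 and
  \<open>9 = 1 + 8\<close>.\<close>

lemma large_family_bound:
  assumes m: "m \<ge> 1" and n: "n \<ge> 1" and \<epsilon>: "0 < \<epsilon>" "\<epsilon> < 1 / 24"
    and N: "N \<ge> 2" "4 * m * N \<le> n" and p: "p > 0"
    and hyp: "\<And>X. X \<subseteq> carrier_vec n \<Longrightarrow> card X = N \<Longrightarrow>
        p \<le> measure_pmf.prob (entries_pmf m n) (preserving m n \<epsilon> X)"
  shows "log 2 N \<le> 9 + log 2 (max 1 (ln (1 / p))) + 96 * (\<epsilon> * sqrt m)"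
proof -
  define s where "s = nat \<lfloor>12 * \<epsilon> * sqrt m\<rfloor> + 1"
  have pos: "0 \<le> 12 * \<epsilon> * sqrt m" using \<epsilon> by simp
  have s: "s \<ge> 1" "12 * \<epsilon> * sqrt m < s" "s \<le> 12 * \<epsilon> * sqrt m + 1"
    using pos unfolding s_def by linarith+
  \<comment> \<open>Unless \<open>s = 1\<close>, rounding up at most doubles
    \<open>12 * \<epsilon> * sqrt m\<close>; this is where \<open>1 / 24\<close> is needed.\<close>
  have "s * s \<le> m"
  proof (cases "12 * \<epsilon> * sqrt m < 1")
    case True
    then have "s = 1" using pos by (simp add: s_def floor_eq_iff)
    then show ?thesis using m by simp
  next
    case False
    have "s \<le> 24 * \<epsilon> * sqrt m" using s(3) False by linarith
    also have "\<dots> \<le> 1 * sqrt m" using \<epsilon> by (intro mult_right_mono) auto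
    finally have "real s * real s \<le> sqrt m * sqrt m" by (intro mult_mono) auto
    then have "real (s * s) \<le> real m" by simp
    then show ?thesis by (simp only: of_nat_le_iff)
  qed
  then have "p \<le> (1 - 1 / 2 ^ (8 * s)) ^ (N - 1)"
    by (rule success_prob_le[OF m n \<epsilon>(1) s(2,1) _ _ N(2) hyp]) (use N in simp_all)
  from log_size_le[OF p this N(1)]
  have "log 2 N \<le> 1 + log 2 (max 1 (ln (1 / p))) + real (8 * s)" .
  also have "\<dots> \<le> 1 + log 2 (max 1 (ln (1 / p))) + 8 * (12 * \<epsilon> * sqrt m + 1)"
    using s(3) by simp
  finally show ?thesis by simp
qed

theorem theorem3:
  shows "\<exists>C::real. C > 0 \<and> (\<forall>p\<^sub>0::real. p\<^sub>0 > 0 \<longrightarrow> (\<exists>c::real. c > 0 \<and>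
    (\<forall>(m::nat) (n::nat) (N::nat) (\<epsilon>::real).
      m \<ge> 1 \<longrightarrow> n \<ge> 1 \<longrightarrow> N \<ge> 1 \<longrightarrow> 0 < \<epsilon> \<longrightarrow> \<epsilon> < C \<longrightarrow>
      (\<forall>X \<subseteq> (carrier_vec n :: real vec set). card X = N \<longrightarrow>
        measure_pmf.prob (entries_pmf m n)
          {\<omega>. let T = toeplitz_mat m n (\<lambda>k. \<omega> (Inl k)); D = diagonal_mat_of n (\<lambda>i. \<omega> (Inr i)) in
            \<forall>x\<in>X. \<forall>y\<in>X.
              \<bar>(l2_norm ((1 / sqrt m) \<cdot>\<^sub>v ((T * D) *\<^sub>v x) - (1 / sqrt m) \<cdot>\<^sub>v ((T * D) *\<^sub>v y)))\<^sup>2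
                - (l2_norm (x - y))\<^sup>2\<bar>
              \<le> \<epsilon> * (l2_norm (x - y))\<^sup>2}
          \<ge> p\<^sub>0) \<longrightarrow>
      real m \<ge> c * (1 / \<epsilon>\<^sup>2) * (log 2 (real N))\<^sup>2 \<or> real m \<ge> c * (real n / real N))))"
proof (rule exI[of _ "1 / 24"], intro conjI allI impI)
  show "(0 :: real) < 1 / 24" by simp
  fix p :: real assume p: "p > 0"
  \<comment> \<open>\<open>\<kappa>\<close> is the additive loss in
    \<open>large_family_bound\<close>. The two parts of \<open>\<delta>\<close> serve large and
    small \<open>m\<close> at the end, and \<open>s\<close> makes \<open>2 / sqrt s < p / 2\<close>.
    In \<open>c\<close>, the constant \<open>36864 = 192^2\<close> lets half of \<open>lg N\<close>
    absorb \<open>96 * \<epsilon> * sqrt m\<close>, the term \<open>1 / s\<close> provides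
    \<open>s * m * N \<le> n\<close>, and the last term turns \<open>lg N \<le> 2 * \<kappa>\<close>
    into \<open>\<epsilon> * sqrt m < \<delta>\<close>.\<close>
  define \<kappa> where "\<kappa> = 9 + log 2 (max 1 (ln (1 / p)))"
  define \<delta> where "\<delta> = min (p / 4) (p ^ 3 / 256)"
  define s where "s = nat \<lfloor>16 / p\<^sup>2\<rfloor> + 1"
  define c where "c = min (1 / 36864) (min (1 / s) ((\<delta> / (2 * \<kappa>))\<^sup>2))"
  have \<kappa>: "\<kappa> \<ge> 9" by (simp add: \<kappa>_def)
  have \<delta>: "\<delta> > 0" "\<delta> \<le> p / 4" "\<delta> \<le> p ^ 3 / 256" using p by (auto simp: \<delta>_def)
  have s: "s \<ge> 1" "16 / p\<^sup>2 < s" unfolding s_def by linarith+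
  have c: "c > 0" "c \<le> 1 / 36864" "c \<le> 1 / s" "c \<le> (\<delta> / (2 * \<kappa>))\<^sup>2"
    using \<delta> \<kappa> s by (auto simp: c_def)
  show "\<exists>c>0. \<forall>(m::nat) (n::nat) (N::nat) (\<epsilon>::real).
      m \<ge> 1 \<longrightarrow> n \<ge> 1 \<longrightarrow> N \<ge> 1 \<longrightarrow> 0 < \<epsilon> \<longrightarrow> \<epsilon> < 1 / 24 \<longrightarrow>
      (\<forall>X \<subseteq> (carrier_vec n :: real vec set). card X = N \<longrightarrow>
        measure_pmf.prob (entries_pmf m n)
          {\<omega>. let T = toeplitz_mat m n (\<lambda>k. \<omega> (Inl k)); D = diagonal_mat_of n (\<lambda>i. \<omega> (Inr i)) in
            \<forall>x\<in>X. \<forall>y\<in>X.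
              \<bar>(l2_norm ((1 / sqrt m) \<cdot>\<^sub>v ((T * D) *\<^sub>v x) - (1 / sqrt m) \<cdot>\<^sub>v ((T * D) *\<^sub>v y)))\<^sup>2
                - (l2_norm (x - y))\<^sup>2\<bar>
              \<le> \<epsilon> * (l2_norm (x - y))\<^sup>2}
          \<ge> p) \<longrightarrow>
      real m \<ge> c * (1 / \<epsilon>\<^sup>2) * (log 2 (real N))\<^sup>2 \<or> real m \<ge> c * (real n / real N)"
    unfolding preserving_def[symmetric]
  proof (intro exI[of _ c] conjI allI impI)
    show "c > 0" by (rule c(1))
    fix m n N :: nat and \<epsilon> :: real
    assume m: "m \<ge> 1" and n: "n \<ge> 1" and N: "N \<ge> 1" and \<epsilon>: "0 < \<epsilon>" "\<epsilon> < 1 / 24"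
      and "\<forall>X \<subseteq> carrier_vec n. card X = N \<longrightarrow> measure_pmf.prob (entries_pmf m n) (preserving m n \<epsilon> X) \<ge> p"
    then have hyp: "\<And>X. X \<subseteq> carrier_vec n \<Longrightarrow> card X = N \<Longrightarrow>
        p \<le> measure_pmf.prob (entries_pmf m n) (preserving m n \<epsilon> X)" by blast
    show "real m \<ge> c * (1 / \<epsilon>\<^sup>2) * (log 2 (real N))\<^sup>2 \<or> real m \<ge> c * (real n / real N)"
    proof (rule ccontr)
      assume neg: "\<not> ?thesis"
      define r where "r = \<epsilon> * sqrt m"
      have r: "r > 0" "r\<^sup>2 = \<epsilon>\<^sup>2 * m" using \<epsilon> m by (auto simp: r_def power_mult_distrib)
      \<comment> \<open>For \<open>N = 1\<close> the logarithm vanishes and the first alternative is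
        trivial.\<close>
      have N2: "N \<ge> 2"
      proof (rule ccontr)
        assume "\<not> N \<ge> 2"
        then have "N = 1" using N by simp
        then show False using neg by simp
      qed
      have "r\<^sup>2 < \<epsilon>\<^sup>2 * (c * (1 / \<epsilon>\<^sup>2) * (log 2 N)\<^sup>2)"
        unfolding r(2) using neg \<epsilon> by (intro mult_strict_left_mono) auto
      also have "\<dots> = c * (log 2 N)\<^sup>2" using \<epsilon> by simp
      finally have r_less: "r\<^sup>2 < c * (log 2 N)\<^sup>2" .
      have size: "t * m * N \<le> n" if "c \<le> 1 / real t" "t \<ge> 1" for t :: nat
      proof -
        have "real m * N < c * n" using neg N by (simp add: field_simps)
        also have "\<dots> \<le> 1 / real t * n" using that by (intro mult_right_mono) auto
        finally have "real (t * m * N) < real n" using that by (simp add: field_simps)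
        then have "t * m * N < n" by (simp only: of_nat_less_iff)
        then show ?thesis by simp
      qed
      have log0: "0 \<le> log 2 N" using N by simp
      have "log 2 N \<le> \<kappa> + 96 * r"
        unfolding \<kappa>_def r_def using size[of 4] c(2)
        by (intro large_family_bound[OF m n \<epsilon> N2 _ p hyp]) auto
      moreover have "192 * r < log 2 N"
      proof (rule power2_less_imp_less[OF _ log0])
        have "(192 * r)\<^sup>2 < 36864 * (c * (log 2 N)\<^sup>2)" using r_less by (simp add: power_mult_distrib)
        also have "\<dots> \<le> 1 * (log 2 N)\<^sup>2"
          using c(2) unfolding mult.assoc[symmetric] by (intro mult_right_mono) auto
        finally show "(192 * r)\<^sup>2 < (log 2 N)\<^sup>2" by simp
      qed
      ultimately have "log 2 N \<le> 2 * \<kappa>" by linarith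
      then have "(log 2 N)\<^sup>2 \<le> (2 * \<kappa>)\<^sup>2" using log0 by (intro power_mono)
      then have "c * (log 2 N)\<^sup>2 \<le> (\<delta> / (2 * \<kappa>))\<^sup>2 * (2 * \<kappa>)\<^sup>2"
        using c by (intro mult_mono) auto
      also have "\<dots> = \<delta>\<^sup>2" using \<kappa> by (simp add: power_mult_distrib power_divide)
      finally have "r\<^sup>2 < \<delta>\<^sup>2" using r_less by linarith
      then have r\<delta>: "r < \<delta>" using \<delta> by (intro power2_less_imp_less[of r \<delta>]) auto
      have single: "p \<le> sign_mean (entry_indices m n) (\<lambda>w. of_bool (\<not> distorted m \<epsilon> J w))"
        if "J \<subseteq> {..<n}" for J
        using undistorted_family_prob[OF m n hyp, where F = "{J}"] that N2 by simp
      show False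
      proof (cases "sqrt m \<ge> 4 / p")
        \<comment> \<open>\<open>2 * \<delta> \<le> p / 2\<close> and
          \<open>1 / sqrt m \<le> p / 4\<close> keep the walk bound below \<open>p\<close>.\<close>
        case True
        have "2 * m * 1 \<le> 4 * m * N" using N by (intro mult_le_mono) auto
        also have "\<dots> \<le> n" using size[of 4] c(2) by simp
        finally have 2: "2 * m \<le> n" by simp
        have "p \<le> (2 * (\<epsilon> * m) + 1) / sqrt m"
          using 2 m by (intro order_trans[OF single success_prob_le_two_columns[OF m \<epsilon>(1) 2]]) auto
        also have "\<dots> = 2 * r + 1 / sqrt m"
        proof -
          have "\<epsilon> * m = r * sqrt m" by (simp add: r_def)
          then show ?thesis using m by (simp add: add_divide_distrib)
        qed
        also have "\<dots> \<le> 2 * r + 1 / (4 / p)"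
          using True p m by (intro add_left_mono divide_left_mono) auto
        finally show False using r\<delta> \<delta> p by simp
      next
        \<comment> \<open>Now \<open>sqrt m < 4 / p\<close>, so the second part of
          \<open>\<delta>\<close> gives \<open>\<epsilon> * m \<le> (p / 8)^2\<close>, and the two
          terms of the bound add up to less than \<open>p\<close>.\<close>
        case False
        have "s * m * 1 \<le> s * m * N" using N by (intro mult_le_mono) auto
        also have "\<dots> \<le> n" using size[of s] c(3) s(1) by simp
        finally have sm: "s * m \<le> n" by simp
        have "(\<lambda>k. k * m) ` {..<s} \<subseteq> {..<n}"
        proof (rule image_subsetI)
          fix k assume "k \<in> {..<s}"
          then have "k * m < s * m" using m by simp
          also have "\<dots> \<le> n" by (rule sm)
          finally show "k * m \<in> {..<n}" by simp
        qed
        from order_trans[OF single[OF this] success_prob_le_many_columns[OF m s(1) \<epsilon>(1) sm]]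
        have "p \<le> 4 * sqrt (\<epsilon> * m) + 2 / sqrt s" .
        moreover have "sqrt (\<epsilon> * m) \<le> p / 8"
        proof (rule real_le_lsqrt)
          have "\<epsilon> * m = r * sqrt m" by (simp add: r_def)
          also have "\<dots> \<le> (p ^ 3 / 256) * (4 / p)"
            using r r\<delta> \<delta> False p by (intro mult_mono) auto
          also have "\<dots> = (p / 8)\<^sup>2" using p by (simp add: power2_eq_square power3_eq_cube)
          finally show "\<epsilon> * m \<le> (p / 8)\<^sup>2" .
        qed (use \<epsilon> p in auto)
        moreover have "2 / sqrt s < p / 2"
        proof -
          have "4 / p < sqrt s"
            using s(2) p by (intro real_less_rsqrt) (simp add: power_divide)
          then show ?thesis using p s by (simp add: field_simps)
        qed
        ultimately show False by linarith
      qed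
    qed
  qed
qed

end
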